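(* There are absolute constants $C,c>0$ such that the following holds. Let $n\ge 2$, let $X,Y\subseteq\{0,1\}^n$ be nonempty, let $f:X\times Y\to\{0,1\}$, and let $\gamma$ denote the largest margin among all realizations of $f$ (equivalently, of the $|X|\times|Y|$ sign matrix $M$ with $M_{xy}=(-1)^{f(x,y)}$), over all dimensions. Then: (i) there exists a repeated fingerprinting protocol for $f$ that uses $r\le C/\gamma^2$ copies of states $|\alpha_x\rangle,|\beta_y\rangle$ of at most $C\log(n/\gamma)$ qubits each; (ii) conversely, every repeated fingerprinting protocol for $f$ uses $r\ge c/\gamma^2$ copies of its states $|\alpha_x\rangle$ and $|\beta_y\rangle$.
   Context: Realization: for $f:X\times Y\to\{0,1\}$, an assignment of unit vectors $\alpha_x\in\mathbb{R}^d$ $(x\in X)$ and $\beta_y\in\mathbb{R}^d$ $(y\in Y)$ is a $d$-dimensional realization of $f$ with margin $\gamma>0$ if $\langle\alpha_x,\beta_y\rangle\ge\gamma$ whenever $f(x,y)=0$ and $\langle\alpha_x,\beta_y\rangle\le-\gamma$ whenever $f(x,y)=1$. Repeated fingerprinting protocol: a quantum protocol in the simultaneous message passing model, where Alice (holding $x\in X$) and Bob (holding $y\in Y$) each send one message to a referee, with no shared randomness or entanglement. Alice sends $r\ge 1$ copies of a $q$-qubit pure state $|\alpha_x\rangle$ and Bob sends $r$ copies of a $q$-qubit pure state $|\beta_y\rangle$, all states having real amplitudes (unit vectors in $\mathbb{R}^{2^q}$). The referee performs $r$ independent swap tests, one on each pair of copies; each swap test outputs the bit $0$ with probability $\frac12+\frac12|\langle\alpha_x|\beta_y\rangle|^2$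 and the bit $1$ otherwise. The referee determines his output from the $r$ resulting bits, and for every $(x,y)$ the output equals $f(x,y)$ with probability at least $2/3$. Moreover the states form a threshold embedding of $f$: there are $\delta_0<\delta_1$ such that $|\langle\alpha_x|\beta_y\rangle|^2\le\delta_0$ whenever $f(x,y)=0$ and $|\langle\alpha_x|\beta_y\rangle|^2\ge\delta_1$ whenever $f(x,y)=1$. *)

theory Defs
  imports "HOL-Probability.Probability" "Jordan_Normal_Form.Matrix"
begin

unbundle no inner_syntax

text \<open>
  Vectors in $\mathbb{R}^d$, with $d$ varying, are elements of \<^term>\<open>carrier_vec d\<close>;
  from here on \<open>\<bullet>\<close> denotes \<^const>\<open>scalar_prod\<close>. The values 0 and 1, both of
  Boolean functions and of measured bits, are \<^term>\<open>False\<close> and \<^term>\<open>True\<close>.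
\<close>

definition unit_vectors :: "nat \<Rightarrow> real vec set" where
  "unit_vectors d = {v \<in> carrier_vec d. v \<bullet> v = 1}"

definition realization ::
    "'x set \<Rightarrow> 'y set \<Rightarrow> ('x \<Rightarrow> 'y \<Rightarrow> bool) \<Rightarrow> nat \<Rightarrow> real \<Rightarrow>
     ('x \<Rightarrow> real vec) \<Rightarrow> ('y \<Rightarrow> real vec) \<Rightarrow> bool" where
  "realization X Y f d \<gamma> \<alpha> \<beta> \<longleftrightarrow>
     \<gamma> > 0 \<and>
     (\<forall>x\<in>X. \<alpha> x \<in> unit_vectors d) \<and>
     (\<forall>y\<in>Y. \<beta> y \<in> unit_vectors d) \<and>
     (\<forall>x\<in>X. \<forall>y\<in>Y. (\<not> f x y \<longrightarrow> \<alpha> x \<bullet> \<beta> y \<ge> \<gamma>) \<and> (f x y \<longrightarrow> \<alpha> x \<bullet> \<beta> y \<le> - \<gamma>))"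

text \<open>
  For finite nonempty \<open>X\<close> and \<open>Y\<close> the set below is nonempty and bounded by 1, and its
  supremum is attained (the vectors can be taken in dimension $|X| + |Y|$, where a compactness
  argument applies), so this is the largest margin.
\<close>

definition max_margin :: "'x set \<Rightarrow> 'y set \<Rightarrow> ('x \<Rightarrow> 'y \<Rightarrow> bool) \<Rightarrow> real" where
  "max_margin X Y f = Sup {\<gamma>. \<exists>d \<alpha> \<beta>. realization X Y f d \<gamma> \<alpha> \<beta>}"

text \<open>
  The bit 1 has probability $1 - (\frac12 + \frac12 \langle a, b\rangle^2)$. For unit vectors this
  lies in $[0,1]$, so \<^const>\<open>bernoulli_pmf\<close> does not truncate.
\<close>

definition swap_test :: "real vec \<Rightarrow> real vec \<Rightarrow> bool pmf" where
  "swap_test a b = bernoulli_pmf (1 - (1/2 + 1/2 * \<bar>a \<bullet> b\<bar>\<^sup>2))"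

definition threshold_embedding ::
    "'x set \<Rightarrow> 'y set \<Rightarrow> ('x \<Rightarrow> 'y \<Rightarrow> bool) \<Rightarrow> ('x \<Rightarrow> real vec) \<Rightarrow> ('y \<Rightarrow> real vec) \<Rightarrow> bool" where
  "threshold_embedding X Y f \<alpha> \<beta> \<longleftrightarrow>
     (\<exists>\<delta>\<^sub>0 \<delta>\<^sub>1. \<delta>\<^sub>0 < \<delta>\<^sub>1 \<and>
        (\<forall>x\<in>X. \<forall>y\<in>Y. (\<not> f x y \<longrightarrow> \<bar>\<alpha> x \<bullet> \<beta> y\<bar>\<^sup>2 \<le> \<delta>\<^sub>0) \<and> (f x y \<longrightarrow> \<bar>\<alpha> x \<bullet> \<beta> y\<bar>\<^sup>2 \<ge> \<delta>\<^sub>1)))"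

text \<open>
  The protocol with \<open>r\<close> copies of the \<open>q\<close>-qubit states \<open>\<alpha> x\<close> and \<open>\<beta> y\<close>. The map \<open>ref\<close> sends the
  list of the \<open>r\<close> measured bits to the distribution of the referee's output; a referee
  without coins is \<open>ref = (\<lambda>bs. return_pmf (g bs))\<close>.
\<close>

definition repeated_fingerprinting ::
    "'x set \<Rightarrow> 'y set \<Rightarrow> ('x \<Rightarrow> 'y \<Rightarrow> bool) \<Rightarrow> nat \<Rightarrow> nat \<Rightarrow>
     ('x \<Rightarrow> real vec) \<Rightarrow> ('y \<Rightarrow> real vec) \<Rightarrow> (bool list \<Rightarrow> bool pmf) \<Rightarrow> bool" where
  "repeated_fingerprinting X Y f r q \<alpha> \<beta> ref \<longleftrightarrow>
     r \<ge> 1 \<and>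
     (\<forall>x\<in>X. \<alpha> x \<in> unit_vectors (2 ^ q)) \<and>
     (\<forall>y\<in>Y. \<beta> y \<in> unit_vectors (2 ^ q)) \<and>
     (\<forall>x\<in>X. \<forall>y\<in>Y.
        pmf (bind_pmf (replicate_pmf r (swap_test (\<alpha> x) (\<beta> y))) ref) (f x y) \<ge> 2/3) \<and>
     threshold_embedding X Y f \<alpha> \<beta>"

end

theory Submission
  imports Defs
begin

text \<open>
  For (i), project a realization of margin at least \<open>\<gamma> / 2\<close> with \<open>k = O(n / \<gamma>\<^sup>2)\<close> random sign vectors
  (Johnson--Lindenstrauss), so that it fits on \<open>O(log (n / \<gamma>))\<close> qubits. The states
  \<open>(1, - \<alpha> x) / sqrt 2\<close> and \<open>(1, \<beta> y) / sqrt 2\<close> have inner product \<open>(1 - \<alpha> x \<bullet> \<beta> y) / 2\<close>, which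
  turns the sign of \<open>\<alpha> x \<bullet> \<beta> y\<close> into a gap of order \<open>\<gamma>\<close> in the swap test probabilities, detected
  by \<open>O(1 / \<gamma>\<^sup>2)\<close> tests.

  For (ii), let \<open>b < a\<close> be the largest squared overlap on zeros of \<open>f\<close> and the smallest one on ones.
  Bhattacharyya coefficients show that \<open>r\<close> is at least of order \<open>(1 - b) / (a - b)\<^sup>2\<close>. Tensor powers of
  the states with exponent \<open>m\<close> of order \<open>1 / (1 - b)\<close> amplify the gap to
  \<open>a ^ m - b ^ m \<ge> (a - b) / (4 * (1 - b))\<close>. Shifting by the midpoint gives a realization whose margin
  is of this order, so \<open>\<gamma>\<^sup>2\<close> is at least a multiple of \<open>1 / r\<close> because \<open>1 - b \<le> 1\<close>.
\<close>

section \<open>Random sign vectors\<close>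

lemma scalar_prod_lessThan:
  "v \<in> carrier_vec d \<Longrightarrow> u \<bullet> v = (\<Sum>i<d. vec_index u i * vec_index v i)"
  by (auto simp: scalar_prod_def lessThan_atLeast0)

lemma unit_vectors_sum: "u \<in> unit_vectors d \<Longrightarrow> (\<Sum>i<d. (vec_index u i)\<^sup>2) = 1"
  by (auto simp: unit_vectors_def scalar_prod_def power2_eq_square lessThan_atLeast0)

text \<open>The expectation over \<open>d\<close> independent uniform signs, as an iterated average
  that needs no measure space. Coordinates from \<open>d\<close> on are 0.\<close>

primrec rademacher_mean :: "nat \<Rightarrow> ((nat \<Rightarrow> real) \<Rightarrow> real) \<Rightarrow> real" where
  "rademacher_mean 0 \<phi> = \<phi> (\<lambda>_. 0)"
| "rademacher_mean (Suc d) \<phi> =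
     (rademacher_mean d (\<lambda>g. \<phi> (g(d := 1))) + rademacher_mean d (\<lambda>g. \<phi> (g(d := - 1)))) / 2"

lemma rademacher_mean_mono:
  assumes "\<And>g. \<phi> g \<le> \<psi> g"
  shows "rademacher_mean d \<phi> \<le> rademacher_mean d \<psi>"
  using assms
proof (induction d arbitrary: \<phi> \<psi>)
  case (Suc d)
  show ?case
    using Suc.IH[of "\<lambda>g. \<phi> (g(d := 1))" "\<lambda>g. \<psi> (g(d := 1))"]
      Suc.IH[of "\<lambda>g. \<phi> (g(d := - 1))" "\<lambda>g. \<psi> (g(d := - 1))"] Suc.prems
    by simp
qed simp

lemma rademacher_mean_const: "rademacher_mean d (\<lambda>_. c) = c"
  by (induction d) auto

lemma rademacher_mean_add:
  "rademacher_mean d (\<lambda>g. \<phi> g + \<psi> g) = rademacher_mean d \<phi> + rademacher_mean d \<psi>"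
  by (induction d arbitrary: \<phi> \<psi>) (auto simp: field_simps)

lemma rademacher_mean_mult_left: "rademacher_mean d (\<lambda>g. c * \<phi> g) = c * rademacher_mean d \<phi>"
  by (induction d arbitrary: \<phi>) (auto simp: field_simps)

lemma rademacher_mean_sum:
  "finite J \<Longrightarrow> rademacher_mean d (\<lambda>g. \<Sum>j\<in>J. \<phi> j g) = (\<Sum>j\<in>J. rademacher_mean d (\<phi> j))"
  by (induction J rule: finite_induct) (auto simp: rademacher_mean_const rademacher_mean_add)

text \<open>The probabilistic method: a strict lower bound valid everywhere passes to the mean. The
  witness is not claimed to be a sign vector; any real coefficients can serve as a row of the
  projection.\<close>

lemma ex_le_rademacher_mean: "\<exists>g. \<phi> g \<le> rademacher_mean d \<phi>"
proof (rule ccontr)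
  assume "\<not> ?thesis"
  then have less: "rademacher_mean d \<phi> < \<phi> g" for g
    by (simp add: not_le)
  have "c < rademacher_mean d \<psi>" if "\<And>g. c < \<psi> g" for \<psi> c
    using that
  proof (induction d arbitrary: \<psi>)
    case (Suc d)
    show ?case
      using Suc.IH[of "\<lambda>g. \<psi> (g(d := 1))"] Suc.IH[of "\<lambda>g. \<psi> (g(d := - 1))"] Suc.prems by simp
  qed simp
  from this[of "rademacher_mean d \<phi>" \<phi>] less show False by simp
qed

abbreviation sign_form :: "nat \<Rightarrow> (nat \<Rightarrow> real) \<Rightarrow> real vec \<Rightarrow> real" where
  "sign_form d g u \<equiv> \<Sum>i<d. g i * vec_index u i"

text \<open>The shifts \<open>a\<close> and \<open>b\<close> absorb the last coordinate in the
  induction, and its sign cancels in the cross terms. Unshifted, a random sign vector estimates the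
  inner product without bias.\<close>

lemma rademacher_mean_product:
  "rademacher_mean d (\<lambda>g. (sign_form d g u + a) * (sign_form d g v + b))
     = (\<Sum>i<d. vec_index u i * vec_index v i) + a * b"
proof (induction d arbitrary: a b)
  case (Suc d)
  have *: "sign_form (Suc d) (g(d := e)) u + a = sign_form d g u + (a + e * vec_index u d)" for g e u a
    by simp
  show ?case
    unfolding rademacher_mean.simps * Suc.IH by (simp add: algebra_simps)
qed simp

section \<open>Exponential moments of Rademacher sums\<close>

lemma cosh_le_exp_square_half: "cosh (x::real) \<le> exp (x\<^sup>2 / 2)"
proof -
  have "cosh x \<le> exp (x\<^sup>2 / 2)" if "x \<ge> 0" for x :: real
  proof -
    define h where "h = (\<lambda>x::real. x\<^sup>2 / 2 - ln (cosh x))"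
    have "h 0 \<le> h x"
    \<comment> \<open>The derivative of \<open>h\<close> is \<open>t - tanh t\<close>, which
      vanishes at 0 and has derivative \<open>(tanh t)\<^sup>2\<close>, so \<open>h\<close> does not
      decrease from \<open>h 0 = 0\<close>.\<close>
    proof (rule DERIV_nonneg_imp_nondecreasing[OF that])
      fix t :: real assume t: "0 \<le> t" "t \<le> x"
      have "(h has_real_derivative (t - tanh t)) (at t)"
        unfolding h_def by (auto intro!: derivative_eq_intros simp: tanh_def)
      moreover have "tanh t \<le> t"
      proof -
        have "(\<lambda>t. t - tanh t) 0 \<le> (\<lambda>t. t - tanh t) (t::real)"
          by (rule DERIV_nonneg_imp_nondecreasing[OF t(1)])
            (auto intro!: derivative_eq_intros exI)
        then show ?thesis by simp
      qed
      ultimately show "\<exists>y. (h has_real_derivative y) (at t) \<and> 0 \<le> y" by force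
    qed
    then have "ln (cosh x) \<le> x\<^sup>2 / 2" by (simp add: h_def)
    then show ?thesis by (metis cosh_real_pos exp_le_cancel_iff exp_ln)
  qed
  from this[of "\<bar>x\<bar>"] show ?thesis by (simp add: cosh_real_abs)
qed

text \<open>
  The shift \<open>c\<close> carries the coordinates already averaged out. One more coordinate turns the
  coefficient \<open>s\<close> of \<open>c\<^sup>2\<close> into at most \<open>s + 2 * s\<^sup>2 * a\<^sup>2\<close>, and \<open>1 / (4 - 2 * \<tau>)\<close> dominates this recursion.
\<close>

lemma rademacher_mean_exp_square_aux:
  assumes "(\<Sum>i<d. (vec_index u i)\<^sup>2) \<le> 1"
  shows "rademacher_mean d (\<lambda>g. exp ((sign_form d g u + c)\<^sup>2 / 4))
    \<le> exp (c\<^sup>2 / (4 - 2 * (\<Sum>i<d. (vec_index u i)\<^sup>2)) + (\<Sum>i<d. (vec_index u i)\<^sup>2) / 2)"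
  using assms
proof (induction d arbitrary: c)
  case (Suc d)
  define \<tau> where "\<tau> = (\<Sum>i<d. (vec_index u i)\<^sup>2)"
  define a where "a = vec_index u d"
  have \<tau>: "0 \<le> \<tau>" "\<tau> + a\<^sup>2 \<le> 1" 
    using Suc.prems by (auto simp: \<tau>_def a_def intro!: sum_nonneg)
  define s where "s = 1 / (4 - 2 * \<tau>)"
  have "a\<^sup>2 \<ge> 0" by simp
  then have "\<tau> \<le> 1" using \<tau> by linarith
  then have s: "0 < s" "s \<le> 1/2" by (auto simp: s_def field_simps)
  have IH: "rademacher_mean d (\<lambda>g. exp ((sign_form d g u + c)\<^sup>2 / 4)) \<le> exp (s * c\<^sup>2 + \<tau> / 2)" for c
    using Suc.IH[of c] \<open>\<tau> \<le> 1\<close> by (simp add: \<tau>_def s_def)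
  have *: "sign_form (Suc d) (g(d := e)) u + c = sign_form d g u + (c + e * a)" for g e
    by (simp add: a_def)
  have "rademacher_mean (Suc d) (\<lambda>g. exp ((sign_form (Suc d) g u + c)\<^sup>2 / 4))
    \<le> (exp (s * (c + a)\<^sup>2 + \<tau> / 2) + exp (s * (c - a)\<^sup>2 + \<tau> / 2)) / 2"
    unfolding rademacher_mean.simps * using IH[of "c + a"] IH[of "c - a"] by simp
  also have "\<dots> = exp (s * c\<^sup>2 + s * a\<^sup>2 + \<tau> / 2) * cosh (2 * s * c * a)"
    by (simp add: cosh_def field_simps power2_eq_square flip: exp_add)
  also have "\<dots> \<le> exp (s * c\<^sup>2 + s * a\<^sup>2 + \<tau> / 2) * exp ((2 * s * c * a)\<^sup>2 / 2)"
    by (intro mult_left_mono cosh_le_exp_square_half) auto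
  also have "\<dots> = exp ((s + 2 * s\<^sup>2 * a\<^sup>2) * c\<^sup>2 + s * a\<^sup>2 + \<tau> / 2)"
    by (simp add: field_simps power2_eq_square flip: exp_add)
  also have "\<dots> \<le> exp (1 / (4 - 2 * (\<tau> + a\<^sup>2)) * c\<^sup>2 + (\<tau> + a\<^sup>2) / 2)"
  proof -
    define w where "w = 4 - 2 * \<tau>"
    have w: "w - 2 * a\<^sup>2 > 0" "w > 0" using \<tau> \<open>\<tau> \<le> 1\<close> by (auto simp: w_def)
    \<comment> \<open>Adding \<open>a\<^sup>2\<close> to \<open>\<tau>\<close> lowers the
      denominator \<open>w\<close> by \<open>2 * a\<^sup>2\<close>; this product shows that the
      reciprocal grows by at least the increment \<open>2 * s\<^sup>2 * a\<^sup>2\<close>.\<close>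
    have "(1 / w + 2 * a\<^sup>2 / w\<^sup>2) * (w - 2 * a\<^sup>2) = 1 - (2 * a\<^sup>2 / w)\<^sup>2"
      using w(2) by (simp add: field_simps power2_eq_square)
    also have "\<dots> \<le> 1" by simp
    finally have "1 / w + 2 * a\<^sup>2 / w\<^sup>2 \<le> 1 / (w - 2 * a\<^sup>2)"
      using w by (simp add: pos_le_divide_eq)
    then have "s + 2 * s\<^sup>2 * a\<^sup>2 \<le> 1 / (4 - 2 * (\<tau> + a\<^sup>2))"
      by (simp add: s_def w_def power_divide algebra_simps)
    moreover have "s * a\<^sup>2 \<le> a\<^sup>2 / 2" using mult_right_mono[OF s(2), of "a\<^sup>2"] by simp
    ultimately have "(s + 2 * s\<^sup>2 * a\<^sup>2) * c\<^sup>2 + s * a\<^sup>2 + \<tau> / 2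
        \<le> 1 / (4 - 2 * (\<tau> + a\<^sup>2)) * c\<^sup>2 + a\<^sup>2 / 2 + \<tau> / 2"
      by (intro add_mono mult_right_mono) auto
    then show ?thesis by (simp add: add_divide_distrib)
  qed
  finally show ?case by (simp add: \<tau>_def a_def)
qed simp

lemma rademacher_mean_exp_square:
  assumes "u \<in> unit_vectors d"
  shows "rademacher_mean d (\<lambda>g. exp ((sign_form d g u)\<^sup>2 / 4)) \<le> exp (1 / 2)"
  using rademacher_mean_exp_square_aux[of u d 0] unit_vectors_sum[OF assms] by simp

lemma exp_le_second_order: 
  fixes x :: real
  shows "exp x \<le> 1 + x + x\<^sup>2 * exp \<bar>x\<bar> / 2"
proof -
  obtain t where t: "\<bar>t\<bar> \<le> \<bar>x\<bar>" "exp x = (\<Sum>m<2. x ^ m / fact m) + exp t / fact 2 * x ^ 2"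
    using Maclaurin_exp_le[of x 2] by auto
  have "exp t * x\<^sup>2 \<le> exp \<bar>x\<bar> * x\<^sup>2"
    using t(1) by (intro mult_right_mono) auto
  with t(2) show ?thesis by (simp add: numeral_2_eq_2 field_simps)
qed

text \<open>Taylor expansion to second order: the linear term has mean
  \<open>t * (u \<bullet> v)\<close>, and the remainder is controlled by the exponential moments of
  the two squared forms, each at most \<open>exp (1 / 2) \<le> 2\<close>.\<close>

lemma rademacher_mean_exp_product:
  assumes u: "u \<in> unit_vectors d" and v: "v \<in> unit_vectors d" and t: "\<bar>t\<bar> \<le> 1 / 8"
  shows "rademacher_mean d (\<lambda>g. exp (t * (sign_form d g u * sign_form d g v)))
    \<le> exp (t * (u \<bullet> v) + 128 * t\<^sup>2)"
proof -
  have pointwise: "exp (t * (a * b)) \<le> 1 + t * (a * b) + 32 * t\<^sup>2 * (exp (a\<^sup>2 / 4) + exp (b\<^sup>2 / 4))"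
    for a b :: real
  proof -
    define w where "w = \<bar>a * b\<bar>"
    have ab: "w \<le> (a\<^sup>2 + b\<^sup>2) / 2"
      unfolding w_def using sum_squares_bound[of a b] sum_squares_bound[of a "- b"] by (auto simp: abs_if)
    have w0: "0 \<le> w" by (simp add: w_def)
    \<comment> \<open>The exponent budget: \<open>w\<^sup>2\<close> costs one factor
      \<open>exp (w / 8)\<close> and the bound on \<open>t\<close> a second. Their product
      \<open>exp (w / 4)\<close> splits by AM-GM into \<open>exp (a\<^sup>2 / 4)\<close> and
      \<open>exp (b\<^sup>2 / 4)\<close>, whose means are bounded.\<close>
    have "(w / 8)\<^sup>2 / 2 \<le> exp (w / 8)"
      using exp_lower_Taylor_quadratic[of "w / 8"] w0 by simp
    then have "w\<^sup>2 \<le> 128 * exp (w / 8)" by (simp add: power_divide)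
    moreover have "exp \<bar>t * (a * b)\<bar> \<le> exp (w / 8)"
      using mult_right_mono[OF t w0] by (simp add: w_def abs_mult)
    ultimately have "w\<^sup>2 * exp \<bar>t * (a * b)\<bar> \<le> 128 * exp (w / 8) * exp (w / 8)"
      by (intro mult_mono) auto
    also have "\<dots> = 128 * exp (w / 4)" by (simp flip: exp_add)
    also have "\<dots> \<le> 128 * exp ((a\<^sup>2 + b\<^sup>2) / 8)" using ab by simp
    also have "\<dots> = 128 * (exp (a\<^sup>2 / 8) * exp (b\<^sup>2 / 8))" by (simp add: add_divide_distrib flip: exp_add)
    also have "\<dots> \<le> 64 * ((exp (a\<^sup>2 / 8))\<^sup>2 + (exp (b\<^sup>2 / 8))\<^sup>2)"
      using sum_squares_bound[of "exp (a\<^sup>2 / 8)" "exp (b\<^sup>2 / 8)"] by simp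
    also have "\<dots> = 64 * (exp (a\<^sup>2 / 4) + exp (b\<^sup>2 / 4))" by (simp add: power2_eq_square flip: exp_add)
    finally have "t\<^sup>2 * (w\<^sup>2 * exp \<bar>t * (a * b)\<bar>) \<le> t\<^sup>2 * (64 * (exp (a\<^sup>2 / 4) + exp (b\<^sup>2 / 4)))"
      by (rule mult_left_mono) auto
    then show ?thesis
      using exp_le_second_order[of "t * (a * b)"] by (simp add: w_def power_mult_distrib algebra_simps)
  qed
  have "rademacher_mean d (\<lambda>g. exp (t * (sign_form d g u * sign_form d g v)))
    \<le> rademacher_mean d (\<lambda>g. 1 + t * (sign_form d g u * sign_form d g v)
         + 32 * t\<^sup>2 * (exp ((sign_form d g u)\<^sup>2 / 4) + exp ((sign_form d g v)\<^sup>2 / 4)))"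
    by (intro rademacher_mean_mono pointwise)
  also have "\<dots> = 1 + t * rademacher_mean d (\<lambda>g. sign_form d g u * sign_form d g v)
      + 32 * t\<^sup>2 * (rademacher_mean d (\<lambda>g. exp ((sign_form d g u)\<^sup>2 / 4))
                 + rademacher_mean d (\<lambda>g. exp ((sign_form d g v)\<^sup>2 / 4)))"
    by (simp only: rademacher_mean_add rademacher_mean_const rademacher_mean_mult_left)
  also have "rademacher_mean d (\<lambda>g. sign_form d g u * sign_form d g v) = u \<bullet> v"
    using rademacher_mean_product[of d u 0 v 0] v by (simp add: scalar_prod_lessThan[of v d u] unit_vectors_def)
  also have "1 + t * (u \<bullet> v) + 32 * t\<^sup>2 * (rademacher_mean d (\<lambda>g. exp ((sign_form d g u)\<^sup>2 / 4))
                 + rademacher_mean d (\<lambda>g. exp ((sign_form d g v)\<^sup>2 / 4)))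
     \<le> 1 + t * (u \<bullet> v) + 32 * t\<^sup>2 * (2 + 2)"
  proof -
    have "exp (1 / 2 :: real) \<le> 2"
      using exp_bound_half[of "1/2::real"] by simp
    then show ?thesis
      using rademacher_mean_exp_square[OF u] rademacher_mean_exp_square[OF v]
      by (intro add_left_mono mult_left_mono add_mono) auto
  qed
  also have "\<dots> \<le> exp (t * (u \<bullet> v) + 128 * t\<^sup>2)"
    using exp_ge_add_one_self[of "t * (u \<bullet> v) + 128 * t\<^sup>2"] by (simp add: algebra_simps)
  finally show ?thesis .
qed

text \<open>
  Method of conditional expectations: the \<open>k\<close> sign vectors are chosen one at a time, so that no
  product distribution is needed.
\<close>

lemma ex_sum_prod_le_rademacher_mean:
  fixes \<phi> :: "'j \<Rightarrow> (nat \<Rightarrow> real) \<Rightarrow> real"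
  assumes J: "finite J" and nonneg: "\<And>j g. j \<in> J \<Longrightarrow> 0 \<le> \<phi> j g"
    and mean: "\<And>j. j \<in> J \<Longrightarrow> rademacher_mean d (\<phi> j) \<le> c"
  shows "\<exists>G. (\<Sum>j\<in>J. \<Prod>i<k. \<phi> j (G i)) \<le> real (card J) * c ^ k"
proof (induction k)
  case (Suc k)
  then obtain G where G: "(\<Sum>j\<in>J. \<Prod>i<k. \<phi> j (G i)) \<le> real (card J) * c ^ k" by blast
  define w where "w = (\<lambda>j. \<Prod>i<k. \<phi> j (G i))"
  have w: "j \<in> J \<Longrightarrow> 0 \<le> w j" for j by (auto simp: w_def intro!: prod_nonneg nonneg)
  \<comment> \<open>Products over the rows already chosen act as nonnegative weights; the next row
    keeps the weighted sum at or below its mean.\<close>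
  obtain g where "(\<Sum>j\<in>J. w j * \<phi> j g) \<le> rademacher_mean d (\<lambda>g. \<Sum>j\<in>J. w j * \<phi> j g)"
    using ex_le_rademacher_mean[of "\<lambda>g. \<Sum>j\<in>J. w j * \<phi> j g" d] by blast
  also have "\<dots> = (\<Sum>j\<in>J. w j * rademacher_mean d (\<phi> j))"
    by (simp only: rademacher_mean_sum[OF J] rademacher_mean_mult_left)
  also have "\<dots> \<le> (\<Sum>j\<in>J. w j * c)" by (intro sum_mono mult_left_mono mean w)
  also have "\<dots> = (\<Sum>j\<in>J. w j) * c" by (simp add: sum_distrib_right)
  also have "\<dots> \<le> real (card J) * c ^ Suc k"
  proof (cases "J = {}")
    case False
    then obtain j where j: "j \<in> J" by blast
    have "0 \<le> rademacher_mean d (\<phi> j)"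
      using rademacher_mean_mono[of "\<lambda>_. 0" "\<phi> j" d] nonneg[OF j] by (simp add: rademacher_mean_const)
    then have "0 \<le> c" using mean[OF j] by linarith
    then show ?thesis using mult_right_mono[OF G, of c] by (simp add: w_def mult_ac)
  qed simp
  finally have "(\<Sum>j\<in>J. w j * \<phi> j g) \<le> real (card J) * c ^ Suc k" .
  moreover have "(\<Prod>i<Suc k. \<phi> j ((G(k := g)) i)) = w j * \<phi> j g" for j
    by (simp add: w_def)
  ultimately show ?case by (intro exI[of _ "G(k := g)"]) (simp only:)
qed simp

text \<open>
  A quadruple \<open>(u, v, t, \<theta>)\<close> encodes a one-sided requirement on the normalised inner product
  \<open>(P u \<bullet> P v) / k\<close> of the projections: it has to be below \<open>\<theta>\<close> if \<open>t > 0\<close> and above \<open>\<theta>\<close> if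
  \<open>t < 0\<close>; \<open>\<bar>t\<bar>\<close> is the exponent used in the Chernoff bound.
\<close>

lemma ex_projection:
  fixes s :: real and J :: "(real vec \<times> real vec \<times> real \<times> real) set"
  assumes J: "finite J"
    and unit: "\<And>u v t \<theta>. (u, v, t, \<theta>) \<in> J \<Longrightarrow> u \<in> unit_vectors d \<and> v \<in> unit_vectors d"
    and t: "\<And>u v t \<theta>. (u, v, t, \<theta>) \<in> J \<Longrightarrow> \<bar>t\<bar> \<le> 1 / 8"
    and drift: "\<And>u v t \<theta>. (u, v, t, \<theta>) \<in> J \<Longrightarrow> t * (u \<bullet> v - \<theta>) + 128 * t\<^sup>2 \<le> - s"
    and k: "real (card J) < exp (s * real k)"
  shows "\<exists>P. (\<forall>u. P u \<in> carrier_vec k) \<and>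
    (\<forall>(u, v, t, \<theta>) \<in> J. t * (P u \<bullet> P v - \<theta> * real k) < 0)"
proof -
  define \<phi> where "\<phi> = (\<lambda>(u, v, t, \<theta>) g. exp (t * (sign_form d g u * sign_form d g v - \<theta>)))"
  have mean: "rademacher_mean d (\<phi> j) \<le> exp (- s)" if "j \<in> J" for j
  proof -
    obtain u v t \<theta> where j: "j = (u, v, t, \<theta>)" by (metis prod_cases4)
    with that have *: "(u, v, t, \<theta>) \<in> J" by simp
    have "rademacher_mean d (\<phi> j)
        = exp (- (t * \<theta>)) * rademacher_mean d (\<lambda>g. exp (t * (sign_form d g u * sign_form d g v)))"
      unfolding rademacher_mean_mult_left[symmetric]
      by (simp add: \<phi>_def j right_diff_distrib flip: exp_add)
    also have "\<dots> \<le> exp (- (t * \<theta>)) * exp (t * (u \<bullet> v) + 128 * t\<^sup>2)"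
      using unit[OF *] t[OF *] by (intro mult_left_mono rademacher_mean_exp_product) auto
    also have "\<dots> = exp (t * (u \<bullet> v - \<theta>) + 128 * t\<^sup>2)"
      by (simp add: algebra_simps flip: exp_add)
    also have "\<dots> \<le> exp (- s)" using drift[OF *] by simp
    finally show ?thesis .
  qed
  have nonneg: "0 \<le> \<phi> j g" for j g by (auto simp: \<phi>_def split: prod.splits)
  obtain G where G: "(\<Sum>j\<in>J. \<Prod>i<k. \<phi> j (G i)) \<le> real (card J) * exp (- s) ^ k"
    by (rule exE[OF ex_sum_prod_le_rademacher_mean[of J \<phi> d "exp (- s)" k, OF J nonneg mean]])
  also have "exp (- s) ^ k = exp (- (s * real k))"
    by (simp flip: exp_of_nat_mult add: mult.commute)
  also have "real (card J) * exp (- (s * real k)) < exp (s * real k) * exp (- (s * real k))"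
    using k by (intro mult_strict_right_mono) auto
  also have "\<dots> = 1" by (simp flip: exp_add)
  finally have total: "(\<Sum>j\<in>J. \<Prod>i<k. \<phi> j (G i)) < 1" .
  define P where "P = (\<lambda>u. vec k (\<lambda>i. sign_form d (G i) u))"
  have "t * (P u \<bullet> P v - \<theta> * real k) < 0" if "(u, v, t, \<theta>) \<in> J" for u v t \<theta>
  proof -
    \<comment> \<open>All summands are nonnegative, so a total below 1 bounds each product by 1. The
      product is an exponential, and its exponent being negative is the requirement.\<close>
    have "(\<Prod>i<k. \<phi> (u, v, t, \<theta>) (G i)) < 1"
      using member_le_sum[OF that, of "\<lambda>j. \<Prod>i<k. \<phi> j (G i)", OF prod_nonneg J] total nonneg
      by simp
    also have "(\<Prod>i<k. \<phi> (u, v, t, \<theta>) (G i))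
        = exp (\<Sum>i<k. t * (sign_form d (G i) u * sign_form d (G i) v - \<theta>))"
      by (simp add: \<phi>_def exp_sum)
    also have "(\<Sum>i<k. t * (sign_form d (G i) u * sign_form d (G i) v - \<theta>)) = t * (P u \<bullet> P v - \<theta> * real k)"
    proof -
      have "P u \<bullet> P v = (\<Sum>i<k. sign_form d (G i) u * sign_form d (G i) v)"
        by (subst scalar_prod_lessThan[of _ k]) (simp_all add: P_def)
      then show ?thesis by (simp add: sum_distrib_left[symmetric] sum_subtractf)
    qed
    finally show ?thesis by simp
  qed
  then show ?thesis by (intro exI[of _ P]) (auto simp: P_def)
qed

section \<open>Margins\<close>

lemma scalar_prod_Cauchy_Schwarz:
  fixes u v :: "real vec"
  assumes "u \<in> carrier_vec d" "v \<in> carrier_vec d"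
  shows "(u \<bullet> v)\<^sup>2 \<le> (u \<bullet> u) * (v \<bullet> v)"
  using Cauchy_Schwarz_ineq_sum[of "vec_index u" "vec_index v" "{..<d}"] assms
  by (simp add: scalar_prod_lessThan power2_eq_square)

lemma unit_vectors_abs_scalar_prod_le:
  assumes "u \<in> unit_vectors d" "v \<in> unit_vectors d"
  shows "\<bar>u \<bullet> v\<bar> \<le> 1"
  using scalar_prod_Cauchy_Schwarz[of u d v] assms by (simp add: unit_vectors_def abs_square_le_1)

lemma realization_margin_le_1:
  assumes "realization X Y f d \<gamma> \<alpha> \<beta>" "X \<noteq> {}" "Y \<noteq> {}"
  shows "\<gamma> \<le> 1"
proof -
  obtain x y where "x \<in> X" "y \<in> Y" using assms by blast
  then have "\<gamma> \<le> \<bar>\<alpha> x \<bullet> \<beta> y\<bar>" "\<bar>\<alpha> x \<bullet> \<beta> y\<bar> \<le> 1"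
    using assms(1) unit_vectors_abs_scalar_prod_le[of "\<alpha> x" d "\<beta> y"]
    by (cases "f x y"; force simp: realization_def)+
  then show ?thesis by linarith
qed

lemma realizationI:
  assumes unit: "\<And>x. x \<in> X \<Longrightarrow> \<alpha> x \<in> unit_vectors d" "\<And>y. y \<in> Y \<Longrightarrow> \<beta> y \<in> unit_vectors d"
    and sign: "\<And>x y. x \<in> X \<Longrightarrow> y \<in> Y \<Longrightarrow> (if f x y then - 1 else 1) * (\<alpha> x \<bullet> \<beta> y) \<ge> \<gamma>"
    and "\<gamma> > 0"
  shows "realization X Y f d \<gamma> \<alpha> \<beta>"
  unfolding realization_def using assms by (fastforce split: if_splits)

text \<open>Standard basis vectors indexed by \<open>X\<close> are paired with the columns of the
  sign matrix, scaled by \<open>1 / sqrt N\<close>. This makes the set of margins in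
  \<open>max_margin\<close> nonempty.\<close>

lemma ex_realization:
  assumes "finite X" "X \<noteq> {}"
  shows "\<exists>d \<gamma> \<alpha> \<beta>. realization X Y f d \<gamma> \<alpha> \<beta>"
proof -
  define N where "N = card X"
  have N: "N > 0" using assms by (simp add: N_def card_gt_0_iff)
  obtain h where h: "bij_betw h {..<N} X"
    using ex_bij_betw_nat_finite[OF assms(1)] by (auto simp: N_def atLeast0LessThan)
  define \<alpha> where "\<alpha> = (\<lambda>x. unit_vec N (inv_into {..<N} h x) :: real vec)"
  define \<beta> where "\<beta> = (\<lambda>y. vec N (\<lambda>i. (if f (h i) y then - 1 else 1) / sqrt N))"
  have index: "inv_into {..<N} h x < N" "h (inv_into {..<N} h x) = x" if "x \<in> X" for x
    using that h by (auto simp: bij_betw_def f_inv_into_f dest: inv_into_into)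
  have "realization X Y f N (1 / sqrt N) \<alpha> \<beta>"
  proof (rule realizationI)
    show "\<alpha> x \<in> unit_vectors N" if "x \<in> X" for x
      using index[OF that] by (simp add: \<alpha>_def unit_vectors_def)
    show "\<beta> y \<in> unit_vectors N" for y
    proof -
      have "\<beta> y \<bullet> \<beta> y = (\<Sum>i<N. 1 / real N)"
        by (subst scalar_prod_lessThan[of _ N], simp add: \<beta>_def, intro sum.cong) (auto simp: \<beta>_def)
      then have "\<beta> y \<bullet> \<beta> y = 1" using N by simp
      moreover have "\<beta> y \<in> carrier_vec N" by (simp add: \<beta>_def)
      ultimately show ?thesis by (simp add: unit_vectors_def)
    qed
    show "(if f x y then - 1 else 1) * (\<alpha> x \<bullet> \<beta> y) \<ge> 1 / sqrt N" if "x \<in> X" for x y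
      using index[OF that] by (simp add: \<alpha>_def \<beta>_def)
  qed (use N in simp)
  then show ?thesis by blast
qed

lemma realization_le_max_margin:
  assumes "realization X Y f d \<gamma> \<alpha> \<beta>" "X \<noteq> {}" "Y \<noteq> {}"
  shows "\<gamma> \<le> max_margin X Y f"
  unfolding max_margin_def
  using assms realization_margin_le_1 by (intro cSup_upper bdd_aboveI[of _ 1]) blast+

lemma max_margin_bounds:
  assumes "finite X" "X \<noteq> {}" "Y \<noteq> {}"
  shows "0 < max_margin X Y f" "max_margin X Y f \<le> 1"
proof -
  obtain d \<gamma> \<alpha> \<beta> where real: "realization X Y f d \<gamma> \<alpha> \<beta>" using ex_realization assms by blast
  then show "0 < max_margin X Y f"
    using realization_le_max_margin[OF real assms(2,3)] by (simp add: realization_def)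
  show "max_margin X Y f \<le> 1"
    unfolding max_margin_def using real realization_margin_le_1 assms
    by (intro cSup_least) blast+
qed

text \<open>Margins arbitrarily close to the supremum suffice for the protocol, so no compactness
  argument is made.\<close>

lemma ex_realization_gt:
  assumes "finite X" "X \<noteq> {}" "\<gamma> < max_margin X Y f"
  shows "\<exists>d \<gamma>' \<alpha> \<beta>. realization X Y f d \<gamma>' \<alpha> \<beta> \<and> \<gamma> < \<gamma>'"
  using assms less_cSupD[of "{\<gamma>. \<exists>d \<alpha> \<beta>. realization X Y f d \<gamma> \<alpha> \<beta>}" \<gamma>] ex_realization[of X Y f]
  by (fastforce simp: max_margin_def)

lemma realization_mono:
  "realization X Y f d \<gamma> \<alpha> \<beta> \<Longrightarrow> 0 < \<gamma>' \<Longrightarrow> \<gamma>' \<le> \<gamma> \<Longrightarrow> realization X Y f d \<gamma>' \<alpha> \<beta>"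
  unfolding realization_def by force

section \<open>Dimension reduction\<close>

definition normalize_vec :: "real vec \<Rightarrow> real vec" where
  "normalize_vec v = (1 / sqrt (v \<bullet> v)) \<cdot>\<^sub>v v"

text \<open>The product of the two norms is at most \<open>K\<close>, so dividing by it leaves a
  margin of \<open>\<gamma>\<close>. No vector is zero: as \<open>X\<close> and \<open>Y\<close> are
  nonempty, each has a partner with nonzero inner product, and Cauchy-Schwarz applies.\<close>

lemma realization_normalize:
  assumes carrier: "\<And>x. x \<in> X \<Longrightarrow> \<alpha> x \<in> carrier_vec k" "\<And>y. y \<in> Y \<Longrightarrow> \<beta> y \<in> carrier_vec k"
    and norm: "\<And>x. x \<in> X \<Longrightarrow> \<alpha> x \<bullet> \<alpha> x \<le> K" "\<And>y. y \<in> Y \<Longrightarrow> \<beta> y \<bullet> \<beta> y \<le> K"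
    and sign: "\<And>x y. x \<in> X \<Longrightarrow> y \<in> Y \<Longrightarrow> (if f x y then - 1 else 1) * (\<alpha> x \<bullet> \<beta> y) \<ge> K * \<gamma>"
    and pos: "K > 0" "\<gamma> > 0" "X \<noteq> {}" "Y \<noteq> {}"
  shows "realization X Y f k \<gamma> (\<lambda>x. normalize_vec (\<alpha> x)) (\<lambda>y. normalize_vec (\<beta> y))"
proof -
  have norm_pos: "0 < \<alpha> x \<bullet> \<alpha> x \<and> 0 < \<beta> y \<bullet> \<beta> y" if "x \<in> X" "y \<in> Y" for x y
  proof -
    have "0 < K * \<gamma>" using pos by simp
    then have "\<alpha> x \<bullet> \<beta> y \<noteq> 0" using sign[OF that] by auto
    then have "0 < (\<alpha> x \<bullet> \<beta> y)\<^sup>2" by simp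
    also have "\<dots> \<le> (\<alpha> x \<bullet> \<alpha> x) * (\<beta> y \<bullet> \<beta> y)"
      using carrier that by (intro scalar_prod_Cauchy_Schwarz)
    finally have "0 < (\<alpha> x \<bullet> \<alpha> x) * (\<beta> y \<bullet> \<beta> y)" .
    moreover have "0 \<le> \<alpha> x \<bullet> \<alpha> x" using carrier(1)[OF that(1)]
      by (simp add: scalar_prod_lessThan[of "\<alpha> x" k] sum_nonneg)
    ultimately show ?thesis by (auto simp: zero_less_mult_iff)
  qed
  have unit: "normalize_vec v \<in> unit_vectors k" if "v \<in> carrier_vec k" "0 < v \<bullet> v" for v
    using that by (simp add: normalize_vec_def unit_vectors_def field_simps)
  show ?thesis
  proof (rule realizationI)
    fix x y assume xy: "x \<in> X" "y \<in> Y"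
    define a b where "a = \<alpha> x \<bullet> \<alpha> x" and "b = \<beta> y \<bullet> \<beta> y"
    have ab: "0 < a" "0 < b" "a \<le> K" "b \<le> K"
      using norm_pos[OF xy] norm xy by (auto simp: a_def b_def)
    have "sqrt a * sqrt b \<le> sqrt K * sqrt K" using ab pos by (intro mult_mono) auto
    then have "sqrt a * sqrt b * \<gamma> \<le> K * \<gamma>" using pos by (intro mult_right_mono) auto
    then have "\<gamma> \<le> (if f x y then - 1 else 1) * (\<alpha> x \<bullet> \<beta> y) / (sqrt a * sqrt b)"
      using sign[OF xy] ab by (subst pos_le_divide_eq) (auto simp: mult_ac)
    also have "\<dots> = (if f x y then - 1 else 1) * (normalize_vec (\<alpha> x) \<bullet> normalize_vec (\<beta> y))"
      using carrier(1)[OF xy(1)] carrier(2)[OF xy(2)]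
      by (simp add: normalize_vec_def a_def b_def smult_scalar_prod_distrib[of _ k] scalar_prod_smult_distrib[of _ k])
    finally show "\<gamma> \<le> (if f x y then - 1 else 1) * (normalize_vec (\<alpha> x) \<bullet> normalize_vec (\<beta> y))" .
  qed (use carrier norm_pos pos unit in blast)+
qed

text \<open>The projection has to meet at most \<open>card X * card Y\<close> conditions keeping
  signed inner products above \<open>\<gamma> / 2 * k\<close>, and at most
  \<open>card X + card Y\<close> conditions keeping squared norms below \<open>2 * k\<close>.
  Normalising with \<open>K = 2 * k\<close> leaves a margin of \<open>\<gamma> / 4\<close>.\<close>

lemma realization_dimension_reduction:
  assumes real: "realization X Y f d \<gamma> \<alpha> \<beta>" and fin: "finite X" "finite Y" and ne: "X \<noteq> {}" "Y \<noteq> {}"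
    and k: "real (card X * card Y + card X + card Y) < exp (\<gamma>\<^sup>2 / 2048 * real k)"
  shows "\<exists>\<alpha> \<beta>. realization X Y f k (\<gamma> / 4) \<alpha> \<beta>"
proof -
  have \<gamma>: "0 < \<gamma>" "\<gamma> \<le> 1" using real realization_margin_le_1[OF real ne] by (auto simp: realization_def)
  have unit: "\<And>x. x \<in> X \<Longrightarrow> \<alpha> x \<in> unit_vectors d" "\<And>y. y \<in> Y \<Longrightarrow> \<beta> y \<in> unit_vectors d"
    using real by (auto simp: realization_def)
  \<comment> \<open>This \<open>t\<close> minimises the exponent
    \<open>- t * \<gamma> / 2 + 128 * t\<^sup>2\<close> of the inner product conditions; the minimum
    is \<open>- (\<gamma>\<^sup>2 / 2048)\<close>.\<close>
  define t where "t = \<gamma> / 512"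
  define \<sigma> where "\<sigma> = (\<lambda>x y. if f x y then - 1 else 1 :: real)"
  \<comment> \<open>The sign of the third entry encodes the direction: for
    \<open>\<sigma> x y = 1\<close> it is negative and demands a value above
    \<open>\<gamma> / 2\<close>, for \<open>\<sigma> x y = - 1\<close> it is positive and demands
    one below \<open>- \<gamma> / 2\<close>.\<close>
  define J1 where "J1 = (\<lambda>(x, y). (\<alpha> x, \<beta> y, - \<sigma> x y * t, \<sigma> x y * (\<gamma> / 2))) ` (X \<times> Y)"
  define J2 where "J2 = (\<lambda>x. (\<alpha> x, \<alpha> x, t, 2 :: real)) ` X"
  define J3 where "J3 = (\<lambda>y. (\<beta> y, \<beta> y, t, 2 :: real)) ` Y"
  have drift1: "- t * \<gamma> / 2 + 128 * t\<^sup>2 = - (\<gamma>\<^sup>2 / 2048)"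
    by (simp add: t_def power2_eq_square field_simps)
  have drift2: "- t + 128 * t\<^sup>2 \<le> - (\<gamma>\<^sup>2 / 2048)"
    using mult_left_mono[of \<gamma> 1 \<gamma>] \<gamma> by (simp add: t_def power2_eq_square)
  have "card (J1 \<union> J2 \<union> J3) \<le> card J1 + card J2 + card J3"
    using card_Un_le[of "J1 \<union> J2" J3] card_Un_le[of J1 J2] by linarith
  also have "\<dots> \<le> card X * card Y + card X + card Y"
    unfolding J1_def J2_def J3_def using fin
    by (intro add_mono) (auto intro: order.trans[OF card_image_le] simp: card_cartesian_product)
  finally have card: "real (card (J1 \<union> J2 \<union> J3)) < exp (\<gamma>\<^sup>2 / 2048 * real k)"
    using k by linarith
  have "\<exists>P. (\<forall>u. P u \<in> carrier_vec k) \<and>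
    (\<forall>(u, v, t, \<theta>) \<in> J1 \<union> J2 \<union> J3. t * (P u \<bullet> P v - \<theta> * real k) < 0)"
  proof (rule ex_projection[where d = d and s = "\<gamma>\<^sup>2 / 2048"])
    show "finite (J1 \<union> J2 \<union> J3)" using fin by (simp add: J1_def J2_def J3_def)
    fix u v t' \<theta> assume "(u, v, t', \<theta>) \<in> J1 \<union> J2 \<union> J3"
    then consider x y where "x \<in> X" "y \<in> Y" "u = \<alpha> x" "v = \<beta> y" "t' = - \<sigma> x y * t" "\<theta> = \<sigma> x y * (\<gamma> / 2)"
      | x where "x \<in> X" "u = \<alpha> x" "v = \<alpha> x" "t' = t" "\<theta> = 2"
      | y where "y \<in> Y" "u = \<beta> y" "v = \<beta> y" "t' = t" "\<theta> = 2"
      by (auto simp: J1_def J2_def J3_def)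
    note cases = this
    show "u \<in> unit_vectors d \<and> v \<in> unit_vectors d" using cases unit by cases auto
    show "\<bar>t'\<bar> \<le> 1 / 8" using cases \<gamma> by cases (auto simp: t_def \<sigma>_def)
    show "t' * (u \<bullet> v - \<theta>) + 128 * t'\<^sup>2 \<le> - (\<gamma>\<^sup>2 / 2048)"
      using cases
    proof cases
      case 1
      have *: "\<gamma> \<le> \<sigma> x y * (\<alpha> x \<bullet> \<beta> y)"
        using real 1(1,2) by (cases "f x y") (force simp: realization_def \<sigma>_def)+
      have \<sigma>2: "\<sigma> x y * \<sigma> x y = 1" by (simp add: \<sigma>_def)
      have "t' * (u \<bullet> v - \<theta>) = - t * (\<sigma> x y * (\<alpha> x \<bullet> \<beta> y)) + t * \<gamma> / 2 * (\<sigma> x y * \<sigma> x y)"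
        unfolding 1 by (simp add: algebra_simps)
      also have "\<dots> \<le> - t * \<gamma> / 2"
        using mult_left_mono[OF *, of t] \<gamma> by (simp add: \<sigma>2 t_def)
      finally have "t' * (u \<bullet> v - \<theta>) \<le> - t * \<gamma> / 2" .
      moreover have "t'\<^sup>2 = t\<^sup>2" using 1 \<sigma>2 by (simp add: power2_eq_square mult_ac)
      ultimately show ?thesis using drift1 by linarith
    qed (use drift2 unit in \<open>auto simp: unit_vectors_def\<close>)
  qed (rule card)
  then obtain P where carrier: "\<And>u. P u \<in> carrier_vec k"
    and P: "\<And>u v t' \<theta>. (u, v, t', \<theta>) \<in> J1 \<union> J2 \<union> J3 \<Longrightarrow> t' * (P u \<bullet> P v - \<theta> * real k) < 0"
    by blast
  have t: "t > 0" using \<gamma> by (simp add: t_def)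
  \<comment> \<open>For \<open>k = 0\<close> the hypothesis on cardinalities would put a positive
    integer strictly below \<open>exp 0 = 1\<close>.\<close>
  have "k > 0"
  proof (rule ccontr)
    assume "\<not> k > 0"
    then have "real (card X * card Y + card X + card Y) < 1" using k by simp
    moreover have "1 \<le> card X" using fin ne by (simp add: Suc_leI card_gt_0_iff)
    ultimately show False by linarith
  qed
  have "realization X Y f k (\<gamma> / 4) (\<lambda>x. normalize_vec (P (\<alpha> x))) (\<lambda>y. normalize_vec (P (\<beta> y)))"
  proof (rule realization_normalize[where K = "2 * real k"])
    show "P (\<alpha> x) \<bullet> P (\<alpha> x) \<le> 2 * real k" if "x \<in> X" for x
      using P[of "\<alpha> x" "\<alpha> x" t 2] that t by (auto simp: J2_def mult_less_0_iff)
    show "P (\<beta> y) \<bullet> P (\<beta> y) \<le> 2 * real k" if "y \<in> Y" for y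
      using P[of "\<beta> y" "\<beta> y" t 2] that t by (auto simp: J3_def mult_less_0_iff)
    fix x y assume xy: "x \<in> X" "y \<in> Y"
    have "- \<sigma> x y * t * (P (\<alpha> x) \<bullet> P (\<beta> y) - \<sigma> x y * (\<gamma> / 2) * real k) < 0"
      by (rule P) (use xy in \<open>auto simp: J1_def\<close>)
    then show "2 * real k * (\<gamma> / 4) \<le> (if f x y then - 1 else 1) * (P (\<alpha> x) \<bullet> P (\<beta> y))"
      using t by (auto simp: \<sigma>_def mult_less_0_iff zero_less_mult_iff split: if_splits)
  qed (use carrier \<gamma> ne \<open>k > 0\<close> in auto)
  then show ?thesis by blast
qed

section \<open>From realizations to protocols\<close>

lemma pmf_bind_bernoulli:
  assumes "0 \<le> p" "p \<le> 1"
  shows "pmf (bind_pmf (bernoulli_pmf p) F) b = p * pmf (F True) b + (1 - p) * pmf (F False) b"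
  using assms by (simp add: pmf_bind mult.commute)

lemma bind_replicate_pmf_Suc:
  "bind_pmf (replicate_pmf (Suc r) D) ref
     = bind_pmf D (\<lambda>x. bind_pmf (replicate_pmf r D) (\<lambda>xs. ref (x # xs)))"
  by (simp add: bind_assoc_pmf bind_return_pmf)

text \<open>
  Chebyshev's inequality for the number of ones, as an induction on the number of trials. The
  parameter \<open>t\<close> is the deviation contributed by earlier trials.
\<close>

lemma pmf_replicate_bernoulli_ge:
  assumes p: "0 \<le> p" "p \<le> 1"
    and ref: "\<And>bs. length bs = r \<Longrightarrow>
       pmf (ref bs) b \<ge> 1 - K * (t + real (length (filter id bs)) - real r * p)\<^sup>2"
  shows "pmf (bind_pmf (replicate_pmf r (bernoulli_pmf p)) ref) b
     \<ge> 1 - K * (real r * (p * (1 - p)) + t\<^sup>2)"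
  using ref
proof (induction r arbitrary: t ref)
  case 0
  then show ?case by (simp add: bind_return_pmf)
next
  case (Suc r)
  have T: "pmf (bind_pmf (replicate_pmf r (bernoulli_pmf p)) (\<lambda>xs. ref (True # xs))) b
     \<ge> 1 - K * (real r * (p * (1 - p)) + (t + 1 - p)\<^sup>2)"
    by (rule Suc.IH, rule order.trans[OF _ Suc.prems]) (auto simp: algebra_simps)
  have F: "pmf (bind_pmf (replicate_pmf r (bernoulli_pmf p)) (\<lambda>xs. ref (False # xs))) b
     \<ge> 1 - K * (real r * (p * (1 - p)) + (t - p)\<^sup>2)"
    by (rule Suc.IH, rule order.trans[OF _ Suc.prems]) (auto simp: algebra_simps)
  \<comment> \<open>Variance and bias of one trial: the average of
    \<open>(t + 1 - p)\<^sup>2\<close> and \<open>(t - p)\<^sup>2\<close> with weights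
    \<open>p\<close> and \<open>1 - p\<close> is \<open>t\<^sup>2 + p * (1 - p)\<close>.\<close>
  have "1 - K * (real (Suc r) * (p * (1 - p)) + t\<^sup>2)
     = p * (1 - K * (real r * (p * (1 - p)) + (t + 1 - p)\<^sup>2))
       + (1 - p) * (1 - K * (real r * (p * (1 - p)) + (t - p)\<^sup>2))"
    by (simp add: algebra_simps power2_eq_square)
  also have "\<dots> \<le> pmf (bind_pmf (replicate_pmf (Suc r) (bernoulli_pmf p)) ref) b"
    unfolding bind_replicate_pmf_Suc pmf_bind_bernoulli[OF p]
    using T F p by (intro add_mono mult_left_mono) auto
  finally show ?case .
qed

text \<open>A wrong answer needs the number of ones to deviate from its mean \<open>r * p\<close> by
  at least \<open>r * D\<close>, which by Chebyshev has probability at most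
  \<open>1 / (4 * r * D\<^sup>2) \<le> 1 / 3\<close>. The output is \<open>True\<close> for few ones
  because a large overlap makes ones rare.\<close>

lemma threshold_test_correct:
  assumes p: "0 \<le> p" "p \<le> 1" and D: "D > 0" and r: "real r * D\<^sup>2 \<ge> 3 / 4"
    and sep: "if b then p + D \<le> \<theta> else \<theta> \<le> p - D"
  shows "pmf (bind_pmf (replicate_pmf r (bernoulli_pmf p))
      (\<lambda>bs. return_pmf (real (length (filter id bs)) < real r * \<theta>))) b \<ge> 2 / 3"
proof -
  \<comment> \<open>This scaling makes the quadratic lower bound nonpositive, hence trivial, as soon
    as the deviation reaches \<open>r * D\<close>.\<close>
  define K where "K = 1 / (real r * D)\<^sup>2"
  have "r > 0" using r by (cases r) auto
  then have rD: "real r * D > 0" using D by simp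
  have "1 - K * (real r * (p * (1 - p)) + 0\<^sup>2) \<le> pmf (bind_pmf (replicate_pmf r (bernoulli_pmf p))
      (\<lambda>bs. return_pmf (real (length (filter id bs)) < real r * \<theta>))) b"
  proof (rule pmf_replicate_bernoulli_ge[OF p])
    fix bs :: "bool list"
    define m where "m = real (length (filter id bs))"
    have "(m < real r * \<theta>) = b" if "\<bar>m - real r * p\<bar> < real r * D"
    proof (cases b)
      case True
      then have "real r * p + real r * D \<le> real r * \<theta>"
        using sep mult_left_mono[of "p + D" \<theta> "real r"] by (simp add: distrib_left)
      then show ?thesis using that True by simp
    next
      case False
      then have "real r * \<theta> \<le> real r * p - real r * D"
        using sep mult_left_mono[of \<theta> "p - D" "real r"] by (simp add: right_diff_distrib)
      then show ?thesis using that False by simp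
    qed
    moreover have "1 - K * (m - real r * p)\<^sup>2 \<le> pmf (return_pmf (m < real r * \<theta>)) b" if "\<not> \<bar>m - real r * p\<bar> < real r * D"
    proof -
      have "(real r * D)\<^sup>2 \<le> (m - real r * p)\<^sup>2"
        using that rD by (intro abs_le_square_iff[THEN iffD1]) auto
      then have "1 \<le> (m - real r * p)\<^sup>2 / (real r * D)\<^sup>2"
        by (simp only: pos_le_divide_eq zero_less_power[OF rD] mult_1)
      then have "1 - K * (m - real r * p)\<^sup>2 \<le> 0" by (simp add: K_def)
      then show ?thesis by (rule order.trans) (rule pmf_nonneg)
    qed
    moreover have "0 \<le> K * (m - real r * p)\<^sup>2" by (simp add: K_def)
    ultimately show "1 - K * (0 + m - real r * p)\<^sup>2 \<le> pmf (return_pmf (m < real r * \<theta>)) b"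
      by (cases "\<bar>m - real r * p\<bar> < real r * D") simp_all
  qed
  moreover have "K * (real r * (p * (1 - p))) \<le> 1 / 3"
  proof -
    have "p * (1 - p) \<le> 1 / 4"
      using zero_le_power2[of "p - 1/2"] by (simp add: power2_eq_square algebra_simps)
    then have "K * (real r * (p * (1 - p))) \<le> K * (real r * (1 / 4))"
      by (intro mult_left_mono) (auto simp: K_def)
    also have "\<dots> = 1 / (4 * (real r * D\<^sup>2))"
      using \<open>r > 0\<close> D by (simp add: K_def field_simps power2_eq_square)
    also have "\<dots> \<le> 1 / 3" using r by (simp add: field_simps)
    finally show ?thesis .
  qed
  ultimately show ?thesis by simp
qed

lemma swap_test_bounds:
  assumes "u \<in> unit_vectors d" "v \<in> unit_vectors d"
  shows "0 \<le> \<bar>u \<bullet> v\<bar>\<^sup>2" "\<bar>u \<bullet> v\<bar>\<^sup>2 \<le> 1"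
  using unit_vectors_abs_scalar_prod_le[OF assms] by (auto simp: abs_square_le_1)

text \<open>Prepending one coordinate gives dimension \<open>k + 1 = 2 ^ q\<close>, so the states
  fill \<open>q\<close> qubits exactly. The bounds \<open>((1 - \<gamma>) / 2)\<^sup>2\<close> and
  \<open>((1 + \<gamma>) / 2)\<^sup>2\<close> on the squared overlaps differ by
  \<open>\<gamma>\<close>.\<close>

lemma realization_imp_protocol:
  assumes real: "realization X Y f k \<gamma> \<alpha> \<beta>" and k: "Suc k = 2 ^ q"
    and r: "real r \<ge> 12 / \<gamma>\<^sup>2" and ne: "X \<noteq> {}" "Y \<noteq> {}"
  shows "\<exists>\<alpha> \<beta> g. repeated_fingerprinting X Y f r q \<alpha> \<beta> (\<lambda>bs. return_pmf (g bs))"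
proof -
  have \<gamma>: "0 < \<gamma>" "\<gamma> \<le> 1" using real realization_margin_le_1[OF real ne] by (auto simp: realization_def)
  define A where "A = (\<lambda>x. (1 / sqrt 2) \<cdot>\<^sub>v vCons 1 (- \<alpha> x))"
  define B where "B = (\<lambda>y. (1 / sqrt 2) \<cdot>\<^sub>v vCons 1 (\<beta> y))"
  have carrier: "\<alpha> x \<in> carrier_vec k" "\<alpha> x \<bullet> \<alpha> x = 1" if "x \<in> X" for x
    using real that by (auto simp: realization_def unit_vectors_def)
  have carrier': "\<beta> y \<in> carrier_vec k" "\<beta> y \<bullet> \<beta> y = 1" if "y \<in> Y" for y
    using real that by (auto simp: realization_def unit_vectors_def)
  have AB: "A x \<bullet> B y = (1 - \<alpha> x \<bullet> \<beta> y) / 2" if "x \<in> X" "y \<in> Y" for x y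
    using carrier[OF that(1)] carrier'[OF that(2)]
    by (simp add: A_def B_def smult_scalar_prod_distrib[of _ "Suc k"] scalar_prod_smult_distrib[of _ "Suc k"])
  have unitA: "A x \<in> unit_vectors (2 ^ q)" if "x \<in> X" for x
    using carrier[OF that] unfolding k[symmetric]
    by (simp add: A_def unit_vectors_def smult_scalar_prod_distrib[of _ "Suc k"] scalar_prod_smult_distrib[of _ "Suc k"])
  have unitB: "B y \<in> unit_vectors (2 ^ q)" if "y \<in> Y" for y
    using carrier'[OF that] unfolding k[symmetric]
    by (simp add: B_def unit_vectors_def smult_scalar_prod_distrib[of _ "Suc k"] scalar_prod_smult_distrib[of _ "Suc k"])
  have low: "\<bar>A x \<bullet> B y\<bar>\<^sup>2 \<le> ((1 - \<gamma>) / 2)\<^sup>2" if "x \<in> X" "y \<in> Y" "\<not> f x y" for x y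
  proof -
    have "\<gamma> \<le> \<alpha> x \<bullet> \<beta> y" "\<bar>\<alpha> x \<bullet> \<beta> y\<bar> \<le> 1"
      using real that unit_vectors_abs_scalar_prod_le[of "\<alpha> x" k "\<beta> y"] by (auto simp: realization_def)
    then show ?thesis unfolding AB[OF that(1,2)] by (intro power_mono) auto
  qed
  have high: "\<bar>A x \<bullet> B y\<bar>\<^sup>2 \<ge> ((1 + \<gamma>) / 2)\<^sup>2" if "x \<in> X" "y \<in> Y" "f x y" for x y
  proof -
    have "\<alpha> x \<bullet> \<beta> y \<le> - \<gamma>"
      using real that by (auto simp: realization_def)
    then have "1 + \<gamma> \<le> 1 - \<alpha> x \<bullet> \<beta> y" by linarith
    then have "(1 + \<gamma>) / 2 \<le> (1 - \<alpha> x \<bullet> \<beta> y) / 2" by (rule divide_right_mono) simp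
    then have "(1 + \<gamma>) / 2 \<le> \<bar>(1 - \<alpha> x \<bullet> \<beta> y) / 2\<bar>" by (rule order.trans) (rule abs_ge_self)
    then show ?thesis unfolding AB[OF that(1,2)] by (rule power_mono) (use \<gamma> in simp)
  qed
  have gap: "((1 + \<gamma>) / 2)\<^sup>2 = (1 + \<gamma>\<^sup>2) / 4 + \<gamma> / 2" "((1 - \<gamma>) / 2)\<^sup>2 = (1 + \<gamma>\<^sup>2) / 4 - \<gamma> / 2"
    by (simp_all add: power2_eq_square field_simps)
  \<comment> \<open>The probability of a one at the midpoint of the two overlap bounds. Each bound
    is \<open>\<gamma> / 2\<close> away from the midpoint and the swap test halves this, which gives
    \<open>D = \<gamma> / 4\<close> and the requirement
    \<open>r \<ge> 12 / \<gamma>\<^sup>2\<close>.\<close>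
  define \<theta> where "\<theta> = 1 - (1 / 2 + 1 / 2 * ((1 + \<gamma>\<^sup>2) / 4))"
  have "repeated_fingerprinting X Y f r q A B
      (\<lambda>bs. return_pmf (real (length (filter id bs)) < real r * \<theta>))"
    unfolding repeated_fingerprinting_def
  proof (intro conjI ballI)
    have "0 < 12 / \<gamma>\<^sup>2" using \<gamma> by simp
    then have "0 < real r" using r by linarith
    then show "1 \<le> r" by simp
    show "threshold_embedding X Y f A B"
      unfolding threshold_embedding_def using low high gap \<gamma>
      by (intro exI[of _ "((1 - \<gamma>) / 2)\<^sup>2"] exI[of _ "((1 + \<gamma>) / 2)\<^sup>2"]) auto
    fix x y assume xy: "x \<in> X" "y \<in> Y"
    show "2 / 3 \<le> pmf (bind_pmf (replicate_pmf r (swap_test (A x) (B y)))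
        (\<lambda>bs. return_pmf (real (length (filter id bs)) < real r * \<theta>))) (f x y)"
      unfolding swap_test_def
    proof (rule threshold_test_correct[where D = "\<gamma> / 4"])
      show "real r * (\<gamma> / 4)\<^sup>2 \<ge> 3 / 4"
        using r \<gamma> by (simp add: field_simps power2_eq_square)
      show "if f x y then 1 - (1 / 2 + 1 / 2 * \<bar>A x \<bullet> B y\<bar>\<^sup>2) + \<gamma> / 4 \<le> \<theta>
          else \<theta> \<le> 1 - (1 / 2 + 1 / 2 * \<bar>A x \<bullet> B y\<bar>\<^sup>2) - \<gamma> / 4"
        using low[OF xy] high[OF xy] unfolding gap \<theta>_def by auto
      show "0 \<le> 1 - (1 / 2 + 1 / 2 * \<bar>A x \<bullet> B y\<bar>\<^sup>2)" "1 - (1 / 2 + 1 / 2 * \<bar>A x \<bullet> B y\<bar>\<^sup>2) \<le> 1"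
        using swap_test_bounds[OF unitA[OF xy(1)] unitB[OF xy(2)]] by linarith+
    qed (use \<gamma> in simp)
  qed (use unitA unitB in auto)
  then show ?thesis
    by (intro exI[of _ A] exI[of _ B] exI[of _ "\<lambda>bs. real (length (filter id bs)) < real r * \<theta>"])
qed

lemma ex_power_of_two:
  fixes b :: real
  assumes "b \<ge> 1"
  shows "\<exists>q::nat. b \<le> 2 ^ q \<and> real q \<le> log 2 b + 1"
proof -
  define q where "q = nat \<lceil>log 2 b\<rceil>"
  have "0 \<le> log 2 b" using assms by simp
  then have q: "log 2 b \<le> real q" "real q \<le> log 2 b + 1" unfolding q_def by linarith+
  then have "b \<le> 2 powr real q" using assms by (subst (asm) log_le_iff) auto
  then show ?thesis using q by (auto simp: powr_realpow)
qed

lemma ex_protocol: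
  fixes X :: "bool list set" and Y :: "bool list set"
  assumes n: "n \<ge> 2" and X: "X \<subseteq> {xs. length xs = n}" "X \<noteq> {}"
    and Y: "Y \<subseteq> {ys. length ys = n}" "Y \<noteq> {}" and \<gamma>_eq: "\<gamma> = max_margin X Y f"
  shows "\<exists>r q \<alpha> \<beta> g. repeated_fingerprinting X Y f r q \<alpha> \<beta> (\<lambda>bs. return_pmf (g bs)) \<and>
     real r \<le> 800 / \<gamma>\<^sup>2 \<and> real q \<le> 800 * log 2 (real n / \<gamma>)"
proof -
  have cube: "finite {xs :: bool list. length xs = n}" "card {xs :: bool list. length xs = n} = 2 ^ n"
    using finite_lists_length_eq[of "UNIV :: bool set" n] card_lists_length_eq[of "UNIV :: bool set" n]
    by (auto simp: card_UNIV_bool)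
  have fin: "finite X" "finite Y" using X Y cube finite_subset by blast+
  have card: "card X \<le> 2 ^ n" "card Y \<le> 2 ^ n"
    using card_mono[OF cube(1) X(1)] card_mono[OF cube(1) Y(1)] cube(2) by auto
  have \<gamma>: "0 < \<gamma>" "\<gamma> \<le> 1" using max_margin_bounds[OF fin(1) X(2) Y(2)] \<gamma>_eq by auto
  obtain d \<gamma>' \<alpha> \<beta> where "realization X Y f d \<gamma>' \<alpha> \<beta>" "\<gamma> / 2 < \<gamma>'"
    using ex_realization_gt[OF fin(1) X(2), of "\<gamma> / 2" Y f] \<gamma> \<gamma>_eq by auto
  then have real: "realization X Y f d (\<gamma> / 2) \<alpha> \<beta>" using \<gamma> by (auto intro: realization_mono)
  \<comment> \<open>Dimension reduction at margin \<open>\<gamma> / 2\<close> has exponent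
    \<open>\<gamma>\<^sup>2 / 8192 * k\<close>; with \<open>k\<close> close to \<open>b\<close> this
    is about \<open>4 * n\<close>, enough to beat at most \<open>3 * 4 ^ n\<close>
    conditions.\<close>
  define b where "b = 32768 * real n / \<gamma>\<^sup>2"
  have \<gamma>2: "0 < \<gamma>\<^sup>2" "\<gamma>\<^sup>2 \<le> 1" using \<gamma> by (auto simp: power_le_one)
  then have b: "32768 * real n \<le> b" unfolding b_def by (simp add: pos_le_divide_eq mult_left_le)
  obtain q where q: "b \<le> 2 ^ q" "real q \<le> log 2 b + 1"
    using ex_power_of_two[of b] b n by force
  \<comment> \<open>One of the \<open>2 ^ q\<close> coordinates is reserved for the constant entry
    of the states.\<close>
  define k where "k = 2 ^ q - (1::nat)"
  have k: "Suc k = 2 ^ q" by (simp add: k_def)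
  have "real (Suc k) = 2 ^ q" unfolding k by simp
  then have kb: "b - 1 \<le> real k" using q by simp
  have "real (card X * card Y + card X + card Y) < exp ((\<gamma> / 2)\<^sup>2 / 2048 * real k)"
  proof -
    have "card X * card Y + card X + card Y \<le> 2 ^ n * 2 ^ n + 2 ^ n + 2 ^ n"
      using card by (intro add_mono mult_mono) auto
    then have "real (card X * card Y + card X + card Y) \<le> 2 ^ n * 2 ^ n + 2 ^ n + 2 ^ n"
      by (metis (mono_tags) of_nat_add of_nat_le_iff of_nat_mult of_nat_numeral of_nat_power)
    also have "\<dots> \<le> 3 * (2 ^ n * 2 ^ n)"
      using one_le_power[of "2::real" n] mult_left_mono[of 1 "2 ^ n" "2 ^ n :: real"] by simp
    also have "\<dots> < exp 2 * (exp 1 ^ n * exp 1 ^ n)"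
    proof -
      have e: "2 < exp (1::real)" using exp_lower_Taylor_quadratic[of 1] by simp
      have "4 \<le> exp (1::real) * exp 1" using e mult_mono[of 2 "exp 1" 2 "exp (1::real)"] by simp
      then have "3 < exp (2::real)" by (simp flip: exp_add)
      moreover have "(2::real) ^ n * 2 ^ n \<le> exp 1 ^ n * exp 1 ^ n"
        using e by (intro mult_mono power_mono) auto
      ultimately show ?thesis by (intro mult_less_le_imp_less) auto
    qed
    also have "\<dots> = exp (2 + 2 * real n)" by (simp flip: exp_add exp_of_nat_mult)
    also have "\<dots> \<le> exp ((\<gamma> / 2)\<^sup>2 / 2048 * real k)"
    proof -
      have "\<gamma>\<^sup>2 * (b - 1) \<le> \<gamma>\<^sup>2 * real k" using kb by (intro mult_left_mono) auto
      moreover have "\<gamma>\<^sup>2 * b = 32768 * real n" using \<gamma> by (simp add: b_def)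
      ultimately have "32768 * real n - 1 \<le> \<gamma>\<^sup>2 * real k" using \<gamma>2 by (simp add: right_diff_distrib)
      then show ?thesis using n by (simp add: power_divide)
    qed
    finally show ?thesis .
  qed
  from realization_dimension_reduction[OF real fin X(2) Y(2) this]
  obtain \<alpha> \<beta> where real': "realization X Y f k (\<gamma> / 8) \<alpha> \<beta>" by auto
  \<comment> \<open>Halving the margin and then projecting leaves \<open>\<gamma> / 8\<close>, hence
    \<open>768 / \<gamma>\<^sup>2\<close> copies; rounding up costs at most one more, and
    \<open>1 \<le> 1 / \<gamma>\<^sup>2\<close>.\<close>
  define r where "r = nat \<lceil>12 / (\<gamma> / 8)\<^sup>2\<rceil>"
  have "0 \<le> 12 / (\<gamma> / 8)\<^sup>2" by simp
  then have r: "12 / (\<gamma> / 8)\<^sup>2 \<le> real r" "real r \<le> 12 / (\<gamma> / 8)\<^sup>2 + 1"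
    unfolding r_def by linarith+
  from realization_imp_protocol[OF real' k r(1) X(2) Y(2)]
  obtain \<alpha> \<beta> g where "repeated_fingerprinting X Y f r q \<alpha> \<beta> (\<lambda>bs. return_pmf (g bs))" by blast
  moreover have "real r \<le> 800 / \<gamma>\<^sup>2"
  proof -
    have "1 \<le> 1 / \<gamma>\<^sup>2" using \<gamma>2 by simp
    then show ?thesis using r(2) by (simp add: power_divide)
  qed
  moreover have "real q \<le> 800 * log 2 (real n / \<gamma>)"
  proof -
    define L where "L = log 2 (real n / \<gamma>)"
    have "2 \<le> real n / \<gamma>" using n \<gamma> by (simp add: pos_le_divide_eq)
    \<comment> \<open>This absorbs the additive constants:
      \<open>q \<le> 16 + 2 * L \<le> 18 * L\<close>.\<close>
    then have "1 \<le> L" unfolding L_def by (subst le_log_iff) auto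
    have "b \<le> 2 ^ 15 * (real n / \<gamma>)\<^sup>2"
    proof -
      have "real n \<le> (real n)\<^sup>2" using n by (simp add: power2_eq_square)
      then show ?thesis unfolding b_def power_divide using \<gamma> by (simp add: divide_right_mono)
    qed
    then have "log 2 b \<le> log 2 (2 ^ 15 * (real n / \<gamma>)\<^sup>2)"
      using b n \<gamma> by (intro log_mono) auto
    also have "\<dots> = 15 + 2 * L"
      using n \<gamma> log_pow_cancel[of 2 15] unfolding L_def by (subst log_mult) (auto simp: log_nat_power)
    finally show ?thesis using q(2) \<open>1 \<le> L\<close> unfolding L_def by linarith
  qed
  ultimately show ?thesis by blast
qed

section \<open>From protocols to realizations\<close>

lemma sqrt_Cauchy_Schwarz:
  fixes a b c d :: real
  assumes "0 \<le> a" "0 \<le> b" "0 \<le> c" "0 \<le> d"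
  shows "sqrt (a * b) + sqrt (c * d) \<le> sqrt ((a + c) * (b + d))"
proof (rule real_le_rsqrt)
  have "2 * (sqrt (a * d) * sqrt (c * b)) \<le> (sqrt (a * d))\<^sup>2 + (sqrt (c * b))\<^sup>2"
    using sum_squares_bound[of "sqrt (a * d)" "sqrt (c * b)"] by (simp add: mult_ac)
  moreover have "sqrt (a * d) * sqrt (c * b) = sqrt (a * b) * sqrt (c * d)"
    by (simp add: real_sqrt_mult)
  ultimately show "(sqrt (a * b) + sqrt (c * d))\<^sup>2 \<le> (a + c) * (b + d)"
    using assms by (simp add: power2_sum algebra_simps)
qed

text \<open>
  The Bhattacharyya coefficient is multiplicative over independent trials and does not decrease
  under postprocessing by the referee.
\<close>

lemma Bhattacharyya_replicate_le:
  assumes p: "0 \<le> p" "p \<le> 1" and p': "0 \<le> p'" "p' \<le> 1"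
  defines "acc \<equiv> \<lambda>p r ref. pmf (bind_pmf (replicate_pmf r (bernoulli_pmf p)) ref) True"
  shows "(sqrt (p * p') + sqrt ((1 - p) * (1 - p'))) ^ r
    \<le> sqrt (acc p r ref * acc p' r ref) + sqrt ((1 - acc p r ref) * (1 - acc p' r ref))"
proof (induction r arbitrary: ref)
  case 0
  have "0 \<le> 1 - pmf (ref []) True" by (simp add: pmf_le_1)
  then show ?case by (simp add: acc_def bind_return_pmf pmf_le_1)
next
  case (Suc r)
  define refT where "refT = (\<lambda>xs. ref (True # xs))"
  define refF where "refF = (\<lambda>xs. ref (False # xs))"
  have acc: "acc p (Suc r) ref = p * acc p r refT + (1 - p) * acc p r refF" if "0 \<le> p" "p \<le> 1" for p
    unfolding acc_def bind_replicate_pmf_Suc pmf_bind_bernoulli[OF that] refT_def refF_def ..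
  have bnd: "0 \<le> acc p r ref" "acc p r ref \<le> 1" for p ref by (auto simp: acc_def pmf_le_1)
  define a where "a = acc p r refT" define b where "b = acc p' r refT"
  define c where "c = acc p r refF" define d where "d = acc p' r refF"
  have abcd: "0 \<le> a" "a \<le> 1" "0 \<le> b" "b \<le> 1" "0 \<le> c" "c \<le> 1" "0 \<le> d" "d \<le> 1"
    using bnd by (auto simp: a_def b_def c_def d_def)
  have "(sqrt (p * p') + sqrt ((1 - p) * (1 - p'))) ^ Suc r
      = sqrt (p * p') * (sqrt (p * p') + sqrt ((1 - p) * (1 - p'))) ^ r
        + sqrt ((1 - p) * (1 - p')) * (sqrt (p * p') + sqrt ((1 - p) * (1 - p'))) ^ r"
    by (simp add: distrib_right)
  also have "\<dots> \<le> sqrt (p * p') * (sqrt (a * b) + sqrt ((1 - a) * (1 - b)))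
        + sqrt ((1 - p) * (1 - p')) * (sqrt (c * d) + sqrt ((1 - c) * (1 - d)))"
    unfolding a_def b_def c_def d_def using p p' by (intro add_mono mult_left_mono Suc.IH) auto
  \<comment> \<open>The terms are regrouped by the referee's output instead of the first bit;
    Cauchy-Schwarz then merges the two terms of each group.\<close>
  also have "\<dots> = (sqrt ((p * a) * (p' * b)) + sqrt (((1 - p) * c) * ((1 - p') * d)))
      + (sqrt ((p * (1 - a)) * (p' * (1 - b))) + sqrt (((1 - p) * (1 - c)) * ((1 - p') * (1 - d))))"
    by (simp add: real_sqrt_mult distrib_left)
  also have "\<dots> \<le> sqrt ((p * a + (1 - p) * c) * (p' * b + (1 - p') * d))
      + sqrt ((p * (1 - a) + (1 - p) * (1 - c)) * (p' * (1 - b) + (1 - p') * (1 - d)))"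
    using p p' abcd by (intro add_mono sqrt_Cauchy_Schwarz mult_nonneg_nonneg) auto
  also have "p * (1 - a) + (1 - p) * (1 - c) = 1 - (p * a + (1 - p) * c)"
    by (simp add: algebra_simps)
  also have "p' * (1 - b) + (1 - p') * (1 - d) = 1 - (p' * b + (1 - p') * d)"
    by (simp add: algebra_simps)
  finally show ?case unfolding acc[OF p] acc[OF p'] a_def b_def c_def d_def .
qed

text \<open>By AM-GM the square of the coefficient is at most
  \<open>1 - (b - a)\<^sup>2 \<le> 8 / 9\<close>, which is below
  \<open>(19 / 20)\<^sup>2\<close>.\<close>

lemma Bhattacharyya_distinguished:
  fixes a b :: real
  assumes a: "0 \<le> a" "a \<le> 1 / 3" and b: "2 / 3 \<le> b" "b \<le> 1"
  shows "sqrt (a * b) + sqrt ((1 - a) * (1 - b)) \<le> 19 / 20"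
proof -
  have "(sqrt (a * b) + sqrt ((1 - a) * (1 - b)))\<^sup>2
      = a * b + (1 - a) * (1 - b) + 2 * (sqrt (a * (1 - a)) * sqrt (b * (1 - b)))"
    using a b by (simp add: power2_sum real_sqrt_mult power_mult_distrib mult_ac)
  also have "2 * (sqrt (a * (1 - a)) * sqrt (b * (1 - b))) \<le> a * (1 - a) + b * (1 - b)"
    using sum_squares_bound[of "sqrt (a * (1 - a))" "sqrt (b * (1 - b))"] a b by (simp add: mult_ac)
  also have "a * b + (1 - a) * (1 - b) + (a * (1 - a) + b * (1 - b)) = 1 - (b - a)\<^sup>2"
    by (simp add: power2_eq_square algebra_simps)
  also have "\<dots> \<le> 1 - (1 / 3)\<^sup>2" using a b by (intro diff_left_mono power_mono) auto
  also have "\<dots> \<le> (19 / 20)\<^sup>2" by (simp add: power2_eq_square)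
  finally show ?thesis by (rule power2_le_imp_le) (simp only: zero_le_divide_iff, simp)
qed

text \<open>The coefficient is 1 minus half the sum of \<open>(sqrt x - sqrt y)\<^sup>2\<close> over
  both outcomes, and each such square is at most \<open>(x - y)\<^sup>2 / x\<close>. As
  \<open>p \<le> 1 / 2\<close>, the denominator \<open>1 - p\<close> may be replaced by
  \<open>p\<close>.\<close>

lemma Bhattacharyya_bernoulli_ge:
  assumes p: "0 \<le> p'" "p' < p" "p \<le> 1 / 2"
  shows "1 - (p - p')\<^sup>2 / p \<le> sqrt (p * p') + sqrt ((1 - p) * (1 - p'))"
proof -
  have sqrt_diff: "(sqrt x - sqrt y)\<^sup>2 \<le> (x - y)\<^sup>2 / x" if "0 < x" "0 \<le> y" for x y :: real
  proof -
    have "(sqrt x - sqrt y)\<^sup>2 * x \<le> (sqrt x - sqrt y)\<^sup>2 * (sqrt x + sqrt y)\<^sup>2"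
      using that power_mono[of "sqrt x" "sqrt x + sqrt y" 2] by (intro mult_left_mono) auto
    also have "\<dots> = (x - y)\<^sup>2"
      using that by (simp add: algebra_simps flip: power_mult_distrib)
    finally show ?thesis using that by (simp add: pos_le_divide_eq)
  qed
  have "(sqrt p - sqrt p')\<^sup>2 + (sqrt (1 - p) - sqrt (1 - p'))\<^sup>2
      \<le> (p - p')\<^sup>2 / p + ((1 - p) - (1 - p'))\<^sup>2 / (1 - p)"
    using p by (intro add_mono sqrt_diff) auto
  also have "\<dots> \<le> (p - p')\<^sup>2 / p + (p - p')\<^sup>2 / p"
    using p by (intro add_mono frac_le) (auto simp: power2_commute)
  finally have "(sqrt p - sqrt p')\<^sup>2 + (sqrt (1 - p) - sqrt (1 - p'))\<^sup>2 \<le> 2 * ((p - p')\<^sup>2 / p)"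
    by simp
  moreover have "(sqrt p - sqrt p')\<^sup>2 = p + p' - 2 * sqrt (p * p')"
    using p by (simp add: power2_diff real_sqrt_mult)
  moreover have "(sqrt (1 - p) - sqrt (1 - p'))\<^sup>2 = (1 - p) + (1 - p') - 2 * sqrt ((1 - p) * (1 - p'))"
    using p by (simp add: power2_diff real_sqrt_mult)
  ultimately show ?thesis by linarith
qed

text \<open>With \<open>h = (p - p')\<^sup>2 / p\<close>, the \<open>r\<close>-th power of the
  single-trial coefficient is at least \<open>(1 - h) ^ r \<ge> 1 - r * h\<close>, while a referee
  who tells the two distributions apart forces it to at most \<open>19 / 20\<close>.\<close>

lemma bernoulli_sample_lower_bound:
  assumes p: "0 \<le> p'" "p' < p" "p \<le> 1 / 2"
    and F: "2 / 3 \<le> pmf (bind_pmf (replicate_pmf r (bernoulli_pmf p)) ref) False"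
    and T: "2 / 3 \<le> pmf (bind_pmf (replicate_pmf r (bernoulli_pmf p')) ref) True"
  shows "1 / 20 \<le> real r * ((p - p')\<^sup>2 / p)"
proof -
  define h where "h = (p - p')\<^sup>2 / p"
  have "(p - p')\<^sup>2 \<le> p * p"
    using p unfolding power2_eq_square by (intro mult_mono) auto
  then have "h \<le> p" using p by (simp add: h_def field_simps)
  then have h: "h \<le> 1" using p by simp
  have "1 + real r * (- h) \<le> (1 + - h) ^ r" using h by (intro Bernoulli_inequality) simp
  also have "\<dots> \<le> (sqrt (p * p') + sqrt ((1 - p) * (1 - p'))) ^ r"
    using Bhattacharyya_bernoulli_ge[OF p] h by (intro power_mono) (auto simp: h_def)
  also have "\<dots> \<le> 19 / 20"
    using p F T by (intro order.trans[OF Bhattacharyya_replicate_le Bhattacharyya_distinguished])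
      (auto simp: pmf_False_conv_True pmf_le_1)
  finally show ?thesis by (simp add: h_def)
qed

section \<open>Kronecker products and tensor powers\<close>

definition tensor_vec :: "real vec \<Rightarrow> real vec \<Rightarrow> real vec" where
  "tensor_vec u v = vec (dim_vec u * dim_vec v)
     (\<lambda>i. vec_index u (i div dim_vec v) * vec_index v (i mod dim_vec v))"

lemma tensor_vec_carrier:
  "u \<in> carrier_vec m \<Longrightarrow> v \<in> carrier_vec n \<Longrightarrow> tensor_vec u v \<in> carrier_vec (m * n)"
  by (auto simp: tensor_vec_def)

lemma sum_div_mod:
  fixes F G :: "nat \<Rightarrow> real"
  shows "(\<Sum>i<m * n. F (i div n) * G (i mod n)) = (\<Sum>i<m. F i) * (\<Sum>j<n. G j)"
proof -
  have "(\<Sum>i<m * n. F (i div n) * G (i mod n)) = (\<Sum>(i, j)\<in>{..<m} \<times> {..<n}. F i * G j)"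
  proof (rule sum.reindex_bij_witness[where j = "\<lambda>i. (i div n, i mod n)" and i = "\<lambda>(i, j). i * n + j"])
    fix a assume "a \<in> {..<m * n}"
    then have "0 < n" "a < m * n" by (auto intro: gr0I)
    then show "(a div n, a mod n) \<in> {..<m} \<times> {..<n}" by (auto simp: less_mult_imp_div_less)
  next
    fix b assume b: "b \<in> {..<m} \<times> {..<n}"
    then obtain i j where ij: "b = (i, j)" "i < m" "j < n" by auto
    then have "i * n + j < Suc i * n" by simp
    also have "\<dots> \<le> m * n" using ij by (intro mult_right_mono) auto
    finally show "(case b of (i, j) \<Rightarrow> i * n + j) \<in> {..<m * n}" using ij by simp
    show "((case b of (i, j) \<Rightarrow> i * n + j) div n, (case b of (i, j) \<Rightarrow> i * n + j) mod n) = b"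
      using ij by simp
  qed auto
  then show ?thesis by (simp add: sum_product sum.cartesian_product)
qed

lemma tensor_vec_scalar_prod:
  assumes "u \<in> carrier_vec m" "u' \<in> carrier_vec m" "v \<in> carrier_vec n" "v' \<in> carrier_vec n"
  shows "tensor_vec u v \<bullet> tensor_vec u' v' = (u \<bullet> u') * (v \<bullet> v')"
proof -
  have "tensor_vec u v \<bullet> tensor_vec u' v'
      = (\<Sum>i<m * n. vec_index u (i div n) * vec_index u' (i div n)
                     * (vec_index v (i mod n) * vec_index v' (i mod n)))"
    using assms tensor_vec_carrier[OF assms(2,4)]
    by (subst scalar_prod_lessThan[of _ "m * n"]) (auto simp: tensor_vec_def mult_ac intro!: sum.cong)
  also have "\<dots> = (u \<bullet> u') * (v \<bullet> v')"
    using sum_div_mod[where F = "\<lambda>i. vec_index u i * vec_index u' i" and G = "\<lambda>i. vec_index v i * vec_index v' i"]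
      assms by (simp add: scalar_prod_lessThan[of u' m] scalar_prod_lessThan[of v' n])
  finally show ?thesis .
qed

primrec tensor_power :: "nat \<Rightarrow> real vec \<Rightarrow> real vec" where
  "tensor_power 0 v = unit_vec 1 0"
| "tensor_power (Suc m) v = tensor_vec v (tensor_power m v)"

lemma tensor_power_carrier: "v \<in> carrier_vec d \<Longrightarrow> tensor_power m v \<in> carrier_vec (d ^ m)"
  by (induction m) (auto intro!: tensor_vec_carrier)

lemma tensor_power_scalar_prod:
  assumes "u \<in> carrier_vec d" "v \<in> carrier_vec d"
  shows "tensor_power m u \<bullet> tensor_power m v = (u \<bullet> v) ^ m"
proof (induction m)
  case (Suc m)
  then show ?case
    using tensor_vec_scalar_prod[OF assms tensor_power_carrier[OF assms(1)] tensor_power_carrier[OF assms(2)]]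
    by simp
qed simp

text \<open>The added coordinates turn the inner product into
  \<open>\<theta> - (\<alpha> x \<bullet> \<beta> y) ^ m\<close> with \<open>\<theta>\<close> the
  midpoint of the gap, so its absolute value is at least \<open>(b - a) / 2\<close>; the factors
  \<open>1 / sqrt 2\<close> halve this. The entry \<open>sqrt (1 - \<theta>\<^sup>2)\<close> meets a
  0 and only makes the length 1.\<close>

lemma realization_of_power_gap:
  assumes unit: "\<And>x. x \<in> X \<Longrightarrow> \<alpha> x \<in> unit_vectors d" "\<And>y. y \<in> Y \<Longrightarrow> \<beta> y \<in> unit_vectors d"
    and gap: "\<And>x y. x \<in> X \<Longrightarrow> y \<in> Y \<Longrightarrow> if f x y then b \<le> (\<alpha> x \<bullet> \<beta> y) ^ m else (\<alpha> x \<bullet> \<beta> y) ^ m \<le> a"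
    and ab: "0 \<le> a" "a < b" "b \<le> 1"
  shows "\<exists>\<alpha> \<beta>. realization X Y f (Suc (Suc (d ^ m))) ((b - a) / 4) \<alpha> \<beta>"
proof -
  define \<theta> where "\<theta> = (a + b) / 2"
  have "\<theta>\<^sup>2 \<le> 1" unfolding \<theta>_def using ab by (simp add: power_le_one)
  define A where "A = (\<lambda>x. (1 / sqrt 2) \<cdot>\<^sub>v vCons 1 (vCons 0 (tensor_power m (\<alpha> x))))"
  define B where "B = (\<lambda>y. (1 / sqrt 2) \<cdot>\<^sub>v vCons \<theta> (vCons (sqrt (1 - \<theta>\<^sup>2)) (- tensor_power m (\<beta> y))))"
  note smult = smult_scalar_prod_distrib[of _ "Suc (Suc (d ^ m))"] scalar_prod_smult_distrib[of _ "Suc (Suc (d ^ m))"]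
  have \<alpha>: "\<alpha> x \<in> carrier_vec d" "\<alpha> x \<bullet> \<alpha> x = 1" "tensor_power m (\<alpha> x) \<in> carrier_vec (d ^ m)" if "x \<in> X" for x
    using unit(1)[OF that] by (auto simp: unit_vectors_def tensor_power_carrier)
  have \<beta>: "\<beta> y \<in> carrier_vec d" "\<beta> y \<bullet> \<beta> y = 1" "tensor_power m (\<beta> y) \<in> carrier_vec (d ^ m)" if "y \<in> Y" for y
    using unit(2)[OF that] by (auto simp: unit_vectors_def tensor_power_carrier)
  have AB: "A x \<bullet> B y = (\<theta> - (\<alpha> x \<bullet> \<beta> y) ^ m) / 2" if "x \<in> X" "y \<in> Y" for x y
    using \<alpha>[OF that(1)] \<beta>[OF that(2)]
    by (simp add: A_def B_def smult tensor_power_scalar_prod[of _ d])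
  have "realization X Y f (Suc (Suc (d ^ m))) ((b - a) / 4) A B"
  proof (rule realizationI)
    show "A x \<in> unit_vectors (Suc (Suc (d ^ m)))" if "x \<in> X" for x
      using \<alpha>[OF that] by (simp add: A_def unit_vectors_def smult tensor_power_scalar_prod[of _ d])
    show "B y \<in> unit_vectors (Suc (Suc (d ^ m)))" if "y \<in> Y" for y
      using \<beta>[OF that] \<open>\<theta>\<^sup>2 \<le> 1\<close>
      by (simp add: B_def unit_vectors_def smult tensor_power_scalar_prod[of _ d] power2_eq_square[symmetric])
    show "(b - a) / 4 \<le> (if f x y then - 1 else 1) * (A x \<bullet> B y)" if "x \<in> X" "y \<in> Y" for x y
      using gap[OF that] by (auto simp: AB[OF that] \<theta>_def field_simps split: if_splits)
  qed (use ab in simp)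
  then show ?thesis by blast
qed

text \<open>A mean value bound: between \<open>b\<close> and \<open>a\<close> the derivative of the
  power is at least its value at \<open>b\<close>.\<close>

lemma power_diff_ge:
  fixes a b :: real
  assumes "0 \<le> b" "b \<le> a"
  shows "real (Suc k) * b ^ k * (a - b) \<le> a ^ Suc k - b ^ Suc k"
proof (induction k)
  case (Suc k)
  have "real (Suc (Suc k)) * b ^ Suc k * (a - b)
      = b * (real (Suc k) * b ^ k * (a - b)) + b ^ Suc k * (a - b)"
    by (simp add: algebra_simps)
  also have "\<dots> \<le> b * (a ^ Suc k - b ^ Suc k) + b ^ Suc k * (a - b)"
    using Suc.IH assms by (intro add_right_mono mult_left_mono) auto
  also have "\<dots> \<le> a * (a ^ Suc k - b ^ Suc k) + b ^ Suc k * (a - b)"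
    using assms power_mono[of b a "Suc k"] by (intro add_right_mono mult_right_mono) auto
  also have "\<dots> = a ^ Suc (Suc k) - b ^ Suc (Suc k)" by (simp add: algebra_simps)
  finally show ?case .
qed simp

text \<open>
  The exponent is about \<open>1 / (2 * (1 - b))\<close>: large enough for the power to amplify the gap
  between \<open>a\<close> and \<open>b\<close>, while the derivative is still at least half the exponent at \<open>b\<close>.
\<close>

lemma ex_amplifying_power:
  fixes a b :: real
  assumes "0 \<le> b" "b < a" "a \<le> 1"
  shows "\<exists>m. (a - b) / (4 * (1 - b)) \<le> a ^ m - b ^ m"
proof -
  define \<eta> where "\<eta> = 1 - b"
  have \<eta>: "0 < \<eta>" "\<eta> \<le> 1" using assms by (auto simp: \<eta>_def)
  define k where "k = nat \<lfloor>1 / (2 * \<eta>)\<rfloor>"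
  have "0 \<le> 1 / (2 * \<eta>)" using \<eta> by simp
  then have k: "real k \<le> 1 / (2 * \<eta>)" "1 / (2 * \<eta>) \<le> real (Suc k)" unfolding k_def by linarith+
  have "1 / 2 \<le> 1 + real k * (- \<eta>)" using k(1) \<eta> by (simp add: field_simps)
  also have "\<dots> \<le> (1 + - \<eta>) ^ k" using \<eta> by (intro Bernoulli_inequality) simp
  finally have half: "1 / 2 \<le> b ^ k" by (simp add: \<eta>_def)
  have "(a - b) / (4 * \<eta>) = 1 / (2 * \<eta>) * (1 / 2) * (a - b)" by simp
  also have "\<dots> \<le> real (Suc k) * b ^ k * (a - b)"
    using k(2) half assms \<eta> by (intro mult_right_mono mult_mono) auto
  also have "\<dots> \<le> a ^ Suc k - b ^ Suc k" using assms by (intro power_diff_ge) auto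
  finally show ?thesis unfolding \<eta>_def by blast
qed

text \<open>Constant functions lack one of the two extreme overlaps compared in the lower bound, so
  their margin is found directly with one-dimensional vectors.\<close>

lemma max_margin_constant:
  assumes "X \<noteq> {}" "Y \<noteq> {}" and const: "\<And>x y. x \<in> X \<Longrightarrow> y \<in> Y \<Longrightarrow> f x y = c"
  shows "1 \<le> max_margin X Y f"
proof (rule realization_le_max_margin)
  show "realization X Y f 1 1 (\<lambda>_. unit_vec 1 0) (\<lambda>_. if c then - unit_vec 1 0 else unit_vec 1 0)"
    using const by (auto simp: realization_def unit_vectors_def)
qed fact+

lemma protocol_lower_bound:
  assumes prot: "repeated_fingerprinting X Y f r q \<alpha> \<beta> ref"
    and fin: "finite X" "finite Y" and ne: "X \<noteq> {}" "Y \<noteq> {}"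
  shows "1 / 2560 / (max_margin X Y f)\<^sup>2 \<le> real r"
proof -
  define \<gamma> where "\<gamma> = max_margin X Y f"
  have r: "1 \<le> r" using prot by (simp add: repeated_fingerprinting_def)
  show ?thesis
  proof (cases "\<exists>c. \<forall>x\<in>X. \<forall>y\<in>Y. f x y = c")
    case True
    then obtain c where c: "\<forall>x\<in>X. \<forall>y\<in>Y. f x y = c" by (elim exE)
    have "1 \<le> \<gamma>"
      unfolding \<gamma>_def by (rule max_margin_constant[OF ne, where c = c]) (use c in simp)
    then have "1 \<le> \<gamma>\<^sup>2" by simp
    moreover from this have "0 < \<gamma>\<^sup>2" by linarith
    ultimately have "1 / 2560 / \<gamma>\<^sup>2 \<le> 1" by (simp add: divide_le_eq)
    then show ?thesis using r unfolding \<gamma>_def by linarith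
  next
    case False
    define s where "s = (\<lambda>(x, y). \<bar>\<alpha> x \<bullet> \<beta> y\<bar>\<^sup>2)"
    define Z where "Z = {z \<in> X \<times> Y. \<not> f (fst z) (snd z)}"
    define W where "W = {z \<in> X \<times> Y. f (fst z) (snd z)}"
    have "finite Z" "finite W" using fin by (simp_all add: Z_def W_def)
    have ex: "\<exists>x\<in>X. \<exists>y\<in>Y. f x y \<noteq> c" for c
    proof (rule ccontr)
      assume "\<not> ?thesis"
      then have "\<forall>x\<in>X. \<forall>y\<in>Y. f x y = c" by simp
      with False show False by (elim notE) (rule exI)
    qed
    obtain x y where "x \<in> X" "y \<in> Y" "f x y \<noteq> True" using ex[of True] by (elim bexE)
    then have "(x, y) \<in> Z" by (simp add: Z_def)
    then have "Z \<noteq> {}" by auto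
    obtain x y where "x \<in> X" "y \<in> Y" "f x y \<noteq> False" using ex[of False] by (elim bexE)
    then have "(x, y) \<in> W" by (simp add: W_def)
    then have "W \<noteq> {}" by auto
    \<comment> \<open>The hardest pairs: \<open>z\<close> has the largest squared overlap among
      zeros of \<open>f\<close>, and \<open>w\<close> the smallest among ones. These two alone give
      the bound on \<open>r\<close>, and by extremality their overlaps separate all other
      pairs.\<close>
    have "Max (s ` Z) \<in> s ` Z" using \<open>finite Z\<close> \<open>Z \<noteq> {}\<close> by (intro Max_in) auto
    then obtain z where z: "z \<in> Z" "s z = Max (s ` Z)" by auto
    have z_max: "s z' \<le> s z" if "z' \<in> Z" for z'
      unfolding z(2) using that \<open>finite Z\<close> by (intro Max_ge) auto
    have "Min (s ` W) \<in> s ` W" using \<open>finite W\<close> \<open>W \<noteq> {}\<close> by (intro Min_in) auto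
    then obtain w where w: "w \<in> W" "s w = Min (s ` W)" by auto
    have w_min: "s w \<le> s w'" if "w' \<in> W" for w'
      unfolding w(2) using that \<open>finite W\<close> by (intro Min_le) auto
    obtain x0 y0 x1 y1 where zw: "z = (x0, y0)" "w = (x1, y1)" by fastforce
    then have mem: "x0 \<in> X" "y0 \<in> Y" "\<not> f x0 y0" "x1 \<in> X" "y1 \<in> Y" "f x1 y1"
      using z(1) w(1) by (auto simp: Z_def W_def)
    have unit: "\<And>x. x \<in> X \<Longrightarrow> \<alpha> x \<in> unit_vectors (2 ^ q)" "\<And>y. y \<in> Y \<Longrightarrow> \<beta> y \<in> unit_vectors (2 ^ q)"
      using prot by (auto simp: repeated_fingerprinting_def)
    define b where "b = s z" define a where "a = s w"
    have "threshold_embedding X Y f \<alpha> \<beta>" using prot by (simp add: repeated_fingerprinting_def)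
    then obtain \<delta>\<^sub>0 \<delta>\<^sub>1 where "\<delta>\<^sub>0 < \<delta>\<^sub>1"
      and \<delta>: "\<And>x y. x \<in> X \<Longrightarrow> y \<in> Y \<Longrightarrow>
        (\<not> f x y \<longrightarrow> \<bar>\<alpha> x \<bullet> \<beta> y\<bar>\<^sup>2 \<le> \<delta>\<^sub>0) \<and> (f x y \<longrightarrow> \<bar>\<alpha> x \<bullet> \<beta> y\<bar>\<^sup>2 \<ge> \<delta>\<^sub>1)"
      unfolding threshold_embedding_def by blast
    then have "b < a"
      using \<delta>[OF mem(1,2)] \<delta>[OF mem(4,5)] mem(3,6) unfolding a_def b_def s_def zw by simp
    moreover have "0 \<le> b" "a \<le> 1"
      using swap_test_bounds[OF unit(1) unit(2)] mem by (auto simp: a_def b_def s_def zw)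
    ultimately have ab: "0 \<le> b" "b < a" "a \<le> 1" by auto
    have succ: "2 / 3 \<le> pmf (bind_pmf (replicate_pmf r (swap_test (\<alpha> x) (\<beta> y))) ref) (f x y)"
      if "x \<in> X" "y \<in> Y" for x y
      using prot that by (simp add: repeated_fingerprinting_def)
    \<comment> \<open>A swap test yields a one with probability half of one minus the squared
      overlap, so the larger probability \<open>p = (1 - b) / 2\<close> belongs to \<open>z\<close>,
      where the output is \<open>False\<close>.\<close>
    have "1 / 20 \<le> real r * (((1 - (1 / 2 + 1 / 2 * b)) - (1 - (1 / 2 + 1 / 2 * a)))\<^sup>2 / (1 - (1 / 2 + 1 / 2 * b)))"
      using succ[OF mem(1,2)] succ[OF mem(4,5)] mem(3,6) ab
      by (intro bernoulli_sample_lower_bound) (auto simp: swap_test_def a_def b_def s_def zw)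
    also have "1 - (1 / 2 + 1 / 2 * b) - (1 - (1 / 2 + 1 / 2 * a)) = (a - b) / 2"
      by (simp add: field_simps)
    also have "1 - (1 / 2 + 1 / 2 * b) = (1 - b) / 2" by (simp add: field_simps)
    also have "((a - b) / 2)\<^sup>2 / ((1 - b) / 2) = (a - b)\<^sup>2 / (2 * (1 - b))"
      by (simp add: power_divide)
    finally have r_ge: "(1 - b) \<le> 10 * (real r * (a - b)\<^sup>2)"
      using ab by (simp add: field_simps)
    obtain m where m: "(a - b) / (4 * (1 - b)) \<le> a ^ m - b ^ m"
      using ex_amplifying_power[OF ab] by blast
    have "0 < (a - b) / (4 * (1 - b))" using ab by simp
    then have "b ^ m < a ^ m" using m by linarith
    \<comment> \<open>The exponent is doubled because \<open>s\<close> is the squared inner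
      product.\<close>
    have "\<exists>\<alpha> \<beta>. realization X Y f (Suc (Suc ((2 ^ q) ^ (2 * m)))) ((a ^ m - b ^ m) / 4) \<alpha> \<beta>"
    proof (rule realization_of_power_gap[OF unit])
      fix x y assume xy: "x \<in> X" "y \<in> Y"
      have s: "(\<alpha> x \<bullet> \<beta> y) ^ (2 * m) = s (x, y) ^ m" by (simp add: s_def power_mult)
      show "if f x y then a ^ m \<le> (\<alpha> x \<bullet> \<beta> y) ^ (2 * m) else (\<alpha> x \<bullet> \<beta> y) ^ (2 * m) \<le> b ^ m"
        unfolding s using z_max[of "(x, y)"] w_min[of "(x, y)"] xy ab
        by (auto simp: a_def b_def Z_def W_def s_def intro!: power_mono)
    qed (use ab \<open>b ^ m < a ^ m\<close> in \<open>auto intro: power_le_one\<close>)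
    then have "(a ^ m - b ^ m) / 4 \<le> \<gamma>"
      unfolding \<gamma>_def using realization_le_max_margin ne by blast
    then have "a ^ m - b ^ m \<le> 4 * \<gamma>" by simp
    with m have le: "(a - b) / (4 * (1 - b)) \<le> 4 * \<gamma>" by (rule order.trans)
    have "0 < 4 * \<gamma>" using \<open>0 < (a - b) / (4 * (1 - b))\<close> le by (rule less_le_trans)
    then have \<gamma>: "0 < \<gamma>" by simp
    have "a - b \<le> 4 * \<gamma> * (4 * (1 - b))" using le ab by (subst (asm) pos_divide_le_eq) auto
    then have "a - b \<le> \<gamma> * (16 * (1 - b))" by (simp add: algebra_simps)
    then have "(a - b)\<^sup>2 \<le> (\<gamma> * (16 * (1 - b)))\<^sup>2"
      using ab by (intro power_mono) auto
    also have "\<dots> = 256 * (1 - b)\<^sup>2 * \<gamma>\<^sup>2"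
      by (simp add: power2_eq_square algebra_simps)
    \<comment> \<open>One of the two factors \<open>1 - b\<close> is bounded by 1; the other cancels
      against the sampling bound, which gives the constant \<open>10 * 256 = 2560\<close>.\<close>
    also have "\<dots> \<le> 256 * (1 - b) * \<gamma>\<^sup>2"
      using ab by (intro mult_right_mono mult_left_mono) (auto simp: power2_eq_square mult_left_le)
    finally have "10 * (real r * (a - b)\<^sup>2) \<le> 10 * (real r * (256 * (1 - b) * \<gamma>\<^sup>2))"
      by (intro mult_left_mono) auto
    with r_ge have "(1 - b) * 1 \<le> (1 - b) * (2560 * (real r * \<gamma>\<^sup>2))"
      by (simp add: algebra_simps)
    then have "1 \<le> 2560 * (real r * \<gamma>\<^sup>2)" using ab by (subst (asm) mult_le_cancel_left_pos) auto
    then show ?thesis using \<gamma> unfolding \<gamma>_def by (simp add: field_simps)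
  qed
qed

theorem theorem3:
  shows "\<exists>C c :: real. C > 0 \<and> c > 0 \<and>
    (\<forall>(n::nat) (X :: bool list set) (Y :: bool list set) (f :: bool list \<Rightarrow> bool list \<Rightarrow> bool) (\<gamma>::real).
       n \<ge> 2 \<longrightarrow>
       X \<subseteq> {xs. length xs = n} \<longrightarrow> X \<noteq> {} \<longrightarrow>
       Y \<subseteq> {ys. length ys = n} \<longrightarrow> Y \<noteq> {} \<longrightarrow>
       \<gamma> = max_margin X Y f \<longrightarrow>
         (\<exists>r q \<alpha> \<beta> g.
            repeated_fingerprinting X Y f r q \<alpha> \<beta> (\<lambda>bs. return_pmf (g bs)) \<and>
            real r \<le> C / \<gamma>\<^sup>2 \<and> real q \<le> C * log 2 (real n / \<gamma>)) \<and>
         (\<forall>r q \<alpha> \<beta> ref.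
            repeated_fingerprinting X Y f r q \<alpha> \<beta> ref \<longrightarrow> real r \<ge> c / \<gamma>\<^sup>2))"
proof -
  have "1 / 2560 / \<gamma>\<^sup>2 \<le> real r"
    if "X \<subseteq> {xs. length xs = n}" "X \<noteq> {}" "Y \<subseteq> {ys. length ys = n}" "Y \<noteq> {}"
      and \<gamma>: "\<gamma> = max_margin X Y f" and prot: "repeated_fingerprinting X Y f r q \<alpha> \<beta> ref"
    for n r q \<gamma> \<alpha> \<beta> ref f and X Y :: "bool list set"
  proof -
    have "finite {xs :: bool list. length xs = n}"
      using finite_lists_length_eq[of "UNIV :: bool set" n] by simp
    then have "finite X" "finite Y" using that by (auto intro: finite_subset)
    then show ?thesis unfolding \<gamma> using that by (intro protocol_lower_bound[OF prot])
  qed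
  note lower = this
  show ?thesis
  proof (rule exI[of _ 800], rule exI[of _ "1 / 2560"], intro conjI allI impI, goal_cases)
    case (3 n X Y f \<gamma>)
    then show ?case by (rule ex_protocol)
  next
    case (4 n X Y f \<gamma> r q \<alpha> \<beta> ref)
    show ?case by (rule lower) fact+
  qed simp_all
qed

end
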